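(* For any clutter $\mathcal{C}$, $\operatorname{pd}(\mathcal{C}) \leq |V(\mathcal{C})| - \epsilon(\mathcal{C})$.
   Context: Fix a field $k$. A clutter $\mathcal{C}$ with finite vertex set $V(\mathcal{C})$ is a set $E(\mathcal{C})$ of subsets of $V(\mathcal{C})$, called edges, such that no edge contains another. Let $S$ be the polynomial ring over $k$ with one variable $x_v$ for each $v \in V(\mathcal{C})$; for $A \subseteq V(\mathcal{C})$ write $x^A = \prod_{v \in A} x_v$, and let $I(\mathcal{C}) = (x^e : e \in E(\mathcal{C})) \subseteq S$. Write $\operatorname{pd}(\mathcal{C})$ for the projective dimension of the $S$-module $S/I(\mathcal{C})$ (usual convention: the zero module has projective dimension $-\infty$). Two distinct vertices of $\mathcal{C}$ are neighbors if some edge of $\mathcal{C}$ contains both. An edge is trivial if it has exactly one element. A vertex is isolated if it lies in no edge, and $\overline{\mathcal{C}}$ denotes $\mathcal{C}$ with its isolated vertices removed. A set $F \subseteq E(\mathcal{C})$ is edgewise dominant if every vertex of $V(\overline{\mathcal{C}})$ that is neither contained in some edge of $F$ nor contained in a trivial edge of $\mathcal{C}$ has a neighbor contained in some edge of $F$. Define $\epsilon(\mathcal{C}) = \min\{|F| : F \subseteq E(\mathcal{C}) \text{ is edgewise dominant}\}$. *)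

theory Defs
  imports
    "HOL-Library.Poly_Mapping"
    "HOL-Library.Extended_Real"
    "HOL-Algebra.QuotRing"
    "HOL-Algebra.Module"
begin

section \<open>Projective dimension\<close>

definition module_hom ::
  "('r, 'x) ring_scheme \<Rightarrow> ('r, 'm, 'y) module_scheme \<Rightarrow> ('r, 'n, 'z) module_scheme \<Rightarrow> ('m \<Rightarrow> 'n) set"
where
  "module_hom R M N = {f \<in> carrier M \<rightarrow> carrier N.
     (\<forall>x\<in>carrier M. \<forall>y\<in>carrier M. f (x \<oplus>\<^bsub>M\<^esub> y) = f x \<oplus>\<^bsub>N\<^esub> f y) \<and>
     (\<forall>a\<in>carrier R. \<forall>x\<in>carrier M. f (a \<odot>\<^bsub>M\<^esub> x) = a \<odot>\<^bsub>N\<^esub> f x)}"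

text \<open>
  Lifting property against all surjections. A HOL definition cannot quantify over types, so the
  modules \<open>N\<close> and \<open>L\<close> have carriers in the type \<^typ>\<open>'p \<Rightarrow> 'r\<close>. This loses nothing: that type
  contains the free module on the elements of \<open>P\<close> and (unless \<open>R\<close> is trivial) a copy of \<open>P\<close>, so
  the lifting property yields a section of the canonical surjection from the former to the latter,
  and hence the lifting property against surjections of arbitrary modules.
\<close>

definition projective_module ::
  "('r, 'x) ring_scheme \<Rightarrow> ('r, 'p) module \<Rightarrow> bool"
where
  "projective_module R P \<longleftrightarrow> Module.module R P \<and>
     (\<forall>(N :: ('r, 'p \<Rightarrow> 'r) module) (L :: ('r, 'p \<Rightarrow> 'r) module) g h.
        Module.module R N \<and> Module.module R L \<and>
        g \<in> module_hom R N L \<and> g ` carrier N = carrier L \<and> h \<in> module_hom R P L \<longrightarrow>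
        (\<exists>h'\<in>module_hom R P N. \<forall>x\<in>carrier P. g (h' x) = h x))"

text \<open>
  \<open>\<cdots> \<rightarrow> P 2 \<rightarrow> P 1 \<rightarrow> P 0 \<rightarrow> M \<rightarrow> 0\<close> is exact, with \<open>d i : P (i + 1) \<rightarrow> P i\<close> and
  augmentation \<open>p : P 0 \<rightarrow> M\<close>.
\<close>

definition projective_resolution ::
  "('r, 'x) ring_scheme \<Rightarrow> ('r, 'm) module \<Rightarrow> (nat \<Rightarrow> ('r, 'p) module) \<Rightarrow>
   (nat \<Rightarrow> 'p \<Rightarrow> 'p) \<Rightarrow> ('p \<Rightarrow> 'm) \<Rightarrow> bool"
where
  "projective_resolution R M P d p \<longleftrightarrow>
     (\<forall>i. projective_module R (P i)) \<and>
     p \<in> module_hom R (P 0) M \<and>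
     (\<forall>i. d i \<in> module_hom R (P (Suc i)) (P i)) \<and>
     p ` carrier (P 0) = carrier M \<and>
     d 0 ` carrier (P 1) = a_kernel (P 0) M p \<and>
     (\<forall>i. d (Suc i) ` carrier (P (Suc (Suc i))) = a_kernel (P (Suc i)) (P i) (d i))"

text \<open>
  The modules of the resolutions have carriers in the type \<^typ>\<open>nat \<times> 'm \<Rightarrow> 'r\<close>, for the same
  reason as above. A shortest projective resolution can be chosen with free terms except for the
  last one, which is a kernel, and with all terms of cardinality at most that of \<open>R\<close>, \<open>M\<close>
  or \<open>\<nat>\<close>, whichever is largest; unless \<open>R\<close> is trivial (and then \<open>M = 0\<close>), the type has room for
  isomorphic copies of these terms. So the value is the minimum over projective resolutions by
  arbitrary modules (and \<open>\<infinity>\<close> if there is no finite one).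
\<close>

definition projective_dimension ::
  "('r, 'x) ring_scheme \<Rightarrow> ('r, 'm) module \<Rightarrow> ereal"
where
  "projective_dimension R M =
     (if carrier M = {\<zero>\<^bsub>M\<^esub>} then -\<infinity>
      else Inf {ereal (real n) | n. \<exists>(P :: nat \<Rightarrow> ('r, nat \<times> 'm \<Rightarrow> 'r) module) d p.
                  projective_resolution R M P d p \<and> (\<forall>i>n. carrier (P i) = {\<zero>\<^bsub>P i\<^esub>})})"

text \<open>The \<open>R\<close>-module \<open>R/I\<close>; the fields \<open>mult\<close> and \<open>one\<close> play no role in a module.\<close>

definition quotient_module ::
  "('r, 'x) ring_scheme \<Rightarrow> 'r set \<Rightarrow> ('r, 'r set) module"
where
  "quotient_module R I =
     \<lparr>carrier = carrier (R Quot I), mult = mult (R Quot I), one = one (R Quot I),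
      zero = zero (R Quot I), add = add (R Quot I),
      smult = (\<lambda>a X. (I +>\<^bsub>R\<^esub> a) \<otimes>\<^bsub>R Quot I\<^esub> X)\<rparr>"


section \<open>Polynomial rings\<close>

text \<open>
  An exponent vector is a \<^typ>\<open>'v \<Rightarrow>\<^sub>0 nat\<close>, a polynomial a finitely supported function from
  exponent vectors to coefficients; multiplication on \<^typ>\<open>('v \<Rightarrow>\<^sub>0 nat) \<Rightarrow>\<^sub>0 'k\<close> is convolution.
  Only the variables in \<open>V\<close> may occur.
\<close>

definition polynomial_ring :: "'v set \<Rightarrow> (('v \<Rightarrow>\<^sub>0 nat) \<Rightarrow>\<^sub>0 'k::field) ring"
where
  "polynomial_ring V =
     \<lparr>carrier = {f. \<forall>m\<in>Poly_Mapping.keys f. Poly_Mapping.keys m \<subseteq> V},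
      mult = (*), one = 1, zero = 0, add = (+)\<rparr>"

definition variable :: "'v \<Rightarrow> ('v \<Rightarrow>\<^sub>0 nat) \<Rightarrow>\<^sub>0 'k::field"
where
  "variable v = Poly_Mapping.single (Poly_Mapping.single v 1) 1"

definition squarefree_monomial :: "'v set \<Rightarrow> ('v \<Rightarrow>\<^sub>0 nat) \<Rightarrow>\<^sub>0 'k::field"
where
  "squarefree_monomial A = (\<Prod>v\<in>A. variable v)"


section \<open>Clutters\<close>

definition clutter :: "'v set \<Rightarrow> 'v set set \<Rightarrow> bool"
where
  "clutter V E \<longleftrightarrow> finite V \<and> E \<subseteq> Pow V \<and> (\<forall>e\<in>E. \<forall>e'\<in>E. e \<subseteq> e' \<longrightarrow> e = e')"

definition neighbors :: "'v set set \<Rightarrow> 'v \<Rightarrow> 'v \<Rightarrow> bool"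
where
  "neighbors E v w \<longleftrightarrow> v \<noteq> w \<and> (\<exists>e\<in>E. v \<in> e \<and> w \<in> e)"

definition isolated :: "'v set set \<Rightarrow> 'v \<Rightarrow> bool"
where
  "isolated E v \<longleftrightarrow> (\<forall>e\<in>E. v \<notin> e)"

definition trivial_edge :: "'v set \<Rightarrow> bool"
where
  "trivial_edge e \<longleftrightarrow> card e = 1"

definition edgewise_dominant :: "'v set \<Rightarrow> 'v set set \<Rightarrow> 'v set set \<Rightarrow> bool"
where
  "edgewise_dominant V E F \<longleftrightarrow> F \<subseteq> E \<and>
     (\<forall>v\<in>V. \<not> isolated E v \<longrightarrow>
        \<not> (\<exists>f\<in>F. v \<in> f) \<longrightarrow> \<not> (\<exists>e\<in>E. trivial_edge e \<and> v \<in> e) \<longrightarrow>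
        (\<exists>w\<in>V. neighbors E v w \<and> (\<exists>f\<in>F. w \<in> f)))"

definition edgewise_domination_number :: "'v set \<Rightarrow> 'v set set \<Rightarrow> nat"
where
  "edgewise_domination_number V E = Min {card F | F. edgewise_dominant V E F}"

definition edge_ideal :: "'v set \<Rightarrow> 'v set set \<Rightarrow> (('v \<Rightarrow>\<^sub>0 nat) \<Rightarrow>\<^sub>0 'k::field) set"
where
  "edge_ideal V E = genideal (polynomial_ring V) (squarefree_monomial ` E)"

definition clutter_pd :: "'k::field itself \<Rightarrow> 'v set \<Rightarrow> 'v set set \<Rightarrow> ereal"
where
  "clutter_pd k V E =
     projective_dimension (polynomial_ring V :: (('v \<Rightarrow>\<^sub>0 nat) \<Rightarrow>\<^sub>0 'k) ring)
       (quotient_module (polynomial_ring V) (edge_ideal V E))"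

end

theory Submission
  imports Defs "HOL-Library.Function_Algebras"
begin

text \<open>
  The proof is an induction on the number of non-isolated vertices with two exact sequences. Write \<open>I\<close> for
  the edge ideal and \<open>v\<close> for a vertex. From \<open>0 \<rightarrow> S / (I : x\<^sub>v) \<rightarrow> S / I \<rightarrow> S / (I + (x\<^sub>v)) \<rightarrow> 0\<close> the projective
  dimension of \<open>S / I\<close> is at most the maximum of those of the outer terms. If \<open>x\<^sub>v\<close> is a nonzerodivisor on
  \<open>S / I\<close>, then adding \<open>x\<^sub>v\<close> to \<open>I\<close> raises the projective dimension by at most one. The colon ideal belongs to
  the clutter with \<open>v\<close> contracted (the minimal sets \<open>e - {v}\<close>), the sum to the one with \<open>v\<close> deleted
  (the edges that avoid \<open>v\<close>), together with the variable \<open>x\<^sub>v\<close>.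

  What is shown is the sharper bound by the number of non-isolated vertices minus the domination number:
  every vertex that becomes isolated in a reduction then pays for one extra edge of a dominating family.
  That covers contractions. A deletion of \<open>v\<close> alone may fail, since nothing then forces \<open>v\<close> to be
  dominated. The remedy is to fix \<open>v\<close> and to delete neighbors of \<open>v\<close> one by one, contracting the current
  neighbor in the other branch, until \<open>v\<close> itself is isolated. In each branch that ends this process,
  some vertex that is lost without being deleted can be charged with an edge through \<open>v\<close>, and this
  one edge dominates all deleted neighbors at once. The counting is in dominant_lift, the induction in
  quotient_resolvable_dominant.

  On the algebraic side it suffices to handle subquotients of finite free modules, with a bound on the
  length of a free resolution defined by recursion through syzygies. The two exact sequences become
  resolvable_extension (the horseshoe lemma) and resolvable_quotient. A squarefree monomial
  ideal is described by the up-closed family of the supports of its monomials, which turns colon ideals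
  and sums into operations on families of sets. Finally, projective_dimension_le converts a chain of
  syzygies into a projective resolution by free modules.
\<close>

section \<open>Finite free resolutions of subquotients of free modules\<close>

text \<open>
  Vectors of length \<open>b\<close> are functions on all naturals that vanish from \<open>b\<close> on, so that free modules of all
  ranks share one type and shorter vectors are among the longer ones. The coefficient ring \<open>K\<close> is a subset
  of a ring type; for polynomials, it consists of those in the given variables.
\<close>

definition vecs :: "'r::comm_ring_1 set \<Rightarrow> nat \<Rightarrow> (nat \<Rightarrow> 'r) set"
where
  "vecs K b = {c. (\<forall>i. c i \<in> K) \<and> (\<forall>i\<ge>b. c i = 0)}"

definition scale :: "'r::comm_ring_1 \<Rightarrow> (nat \<Rightarrow> 'r) \<Rightarrow> nat \<Rightarrow> 'r"
where
  "scale a x = (\<lambda>j. a * x j)"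

definition lincomb :: "nat \<Rightarrow> (nat \<Rightarrow> 'r::comm_ring_1) \<Rightarrow> (nat \<Rightarrow> nat \<Rightarrow> 'r) \<Rightarrow> nat \<Rightarrow> 'r"
where
  "lincomb b c g = (\<lambda>j. \<Sum>i<b. c i * g i j)"

definition submod :: "'r::comm_ring_1 set \<Rightarrow> (nat \<Rightarrow> 'r) set \<Rightarrow> bool"
where
  "submod K M \<longleftrightarrow> 0 \<in> M \<and> (\<forall>x\<in>M. \<forall>y\<in>M. x + y \<in> M) \<and> (\<forall>a\<in>K. \<forall>x\<in>M. scale a x \<in> M)"

definition linear_on ::
  "'r::comm_ring_1 set \<Rightarrow> (nat \<Rightarrow> 'r) set \<Rightarrow> ((nat \<Rightarrow> 'r) \<Rightarrow> nat \<Rightarrow> 'r) \<Rightarrow> bool"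
where
  "linear_on K M f \<longleftrightarrow> (\<forall>x\<in>M. \<forall>y\<in>M. f (x + y) = f x + f y) \<and>
     (\<forall>a\<in>K. \<forall>x\<in>M. f (scale a x) = scale a (f x))"

definition syz ::
  "'r::comm_ring_1 set \<Rightarrow> nat \<Rightarrow> (nat \<Rightarrow> nat \<Rightarrow> 'r) \<Rightarrow> (nat \<Rightarrow> 'r) set \<Rightarrow> (nat \<Rightarrow> 'r) set"
where
  "syz K b g N = {c \<in> vecs K b. lincomb b c g \<in> N}"

definition generates ::
  "'r::comm_ring_1 set \<Rightarrow> nat \<Rightarrow> (nat \<Rightarrow> nat \<Rightarrow> 'r) \<Rightarrow> (nat \<Rightarrow> 'r) set \<Rightarrow> (nat \<Rightarrow> 'r) set \<Rightarrow> bool"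
where
  "generates K b g M N \<longleftrightarrow> (\<forall>i<b. g i \<in> M) \<and> (\<forall>x\<in>M. \<exists>c\<in>vecs K b. x - lincomb b c g \<in> N)"

text \<open>
  There is an exact sequence \<open>0 \<rightarrow> F\<^sub>n\<^sub>-\<^sub>1 \<rightarrow> \<cdots> \<rightarrow> F\<^sub>0 \<rightarrow> M / N \<rightarrow> 0\<close> with finite free modules \<open>F\<^sub>i\<close>, so that
  the projective dimension is at most \<open>n - 1\<close>. With this shift the recursion ends at the zero module,
  the easiest start for inductions. Quotients occur only in the first step: every later module is
  a syzygy module inside a free module.
\<close>

primrec resolvable ::
  "'r::comm_ring_1 set \<Rightarrow> nat \<Rightarrow> (nat \<Rightarrow> 'r) set \<Rightarrow> (nat \<Rightarrow> 'r) set \<Rightarrow> bool"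
where
  "resolvable K 0 M N \<longleftrightarrow> M \<subseteq> N"
| "resolvable K (Suc n) M N \<longleftrightarrow>
     (\<exists>b g. generates K b g M N \<and> resolvable K n (syz K b g N) {0})"

lemma scale_simps [simp]:
  "scale a x j = a * x j" "scale 0 x = 0" "scale 1 x = x" "scale (-1) x = - x"
  "scale a (x + y) = scale a x + scale a y" "scale a 0 = 0"
  by (auto simp: scale_def fun_eq_iff algebra_simps)

lemma lincomb_Suc: "lincomb (Suc b) c g = lincomb b c g + scale (c b) (g b)"
  by (auto simp: lincomb_def fun_eq_iff)

lemma lincomb_0 [simp]: "lincomb 0 c g = 0"
  by (auto simp: lincomb_def fun_eq_iff)

lemma lincomb_add: "lincomb b (c + d) g = lincomb b c g + lincomb b d g"
  by (auto simp: lincomb_def fun_eq_iff algebra_simps sum.distrib)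

lemma lincomb_scale: "lincomb b (scale a c) g = scale a (lincomb b c g)"
  by (auto simp: lincomb_def fun_eq_iff algebra_simps sum_distrib_left)

lemma lincomb_uminus: "lincomb b (- c) g = - lincomb b c g"
  by (auto simp: lincomb_def fun_eq_iff sum_negf)

lemma lincomb_zero [simp]: "lincomb b 0 g = 0"
  by (auto simp: lincomb_def fun_eq_iff)

lemma lincomb_cong:
  "(\<And>i. i < b \<Longrightarrow> c i = d i) \<Longrightarrow> (\<And>i. i < b \<Longrightarrow> g i = h i) \<Longrightarrow> lincomb b c g = lincomb b d h"
  by (auto simp: lincomb_def fun_eq_iff)

lemma lincomb_diff_gens: "lincomb b c g - lincomb b c h = lincomb b c (\<lambda>i. g i - h i)"
  by (auto simp: lincomb_def fun_eq_iff sum_subtractf algebra_simps)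

lemma lincomb_append:
  "lincomb (b + b') c (\<lambda>i. if i < b then g i else h (i - b))
     = lincomb b c g + lincomb b' (\<lambda>i. c (b + i)) h"
proof (induction b')
  case 0
  show ?case by (auto intro: lincomb_cong)
next
  case (Suc b')
  then show ?case by (simp add: lincomb_Suc add.assoc)
qed

lemma vecs_0: "0 \<in> K \<Longrightarrow> vecs K 0 = {0}"
  by (auto simp: vecs_def)

locale coefficients =
  fixes K :: "'r::comm_ring_1 set"
  assumes zero [simp]: "0 \<in> K"
    and one [simp]: "1 \<in> K"
    and add [simp]: "a \<in> K \<Longrightarrow> b \<in> K \<Longrightarrow> a + b \<in> K"
    and mult [simp]: "a \<in> K \<Longrightarrow> b \<in> K \<Longrightarrow> a * b \<in> K"
    and neg [simp]: "a \<in> K \<Longrightarrow> - a \<in> K"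
begin

lemma submodD:
  assumes "submod K M"
  shows "0 \<in> M" "x \<in> M \<Longrightarrow> y \<in> M \<Longrightarrow> x + y \<in> M" "a \<in> K \<Longrightarrow> x \<in> M \<Longrightarrow> scale a x \<in> M"
    "x \<in> M \<Longrightarrow> - x \<in> M" "x \<in> M \<Longrightarrow> y \<in> M \<Longrightarrow> x - y \<in> M"
proof -
  show *: "0 \<in> M" "x \<in> M \<Longrightarrow> y \<in> M \<Longrightarrow> x + y \<in> M" "a \<in> K \<Longrightarrow> x \<in> M \<Longrightarrow> scale a x \<in> M" for a x y
    using assms by (auto simp: submod_def)
  show **: "x \<in> M \<Longrightarrow> - x \<in> M" for x
    using *(3)[of "-1" x] by simp
  show "x \<in> M \<Longrightarrow> y \<in> M \<Longrightarrow> x - y \<in> M"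
    using *(2)[of x "- y"] ** by simp
qed

lemma submod_cong:
  assumes "submod K N" "x - y \<in> N"
  shows "x \<in> N \<longleftrightarrow> y \<in> N"
  using submodD(5)[OF assms(1), of x "x - y"] submodD(2)[OF assms(1), of y "x - y"] assms(2) by auto

lemma submod_zero [simp]: "submod K {0}"
  by (auto simp: submod_def)

lemma submod_vecs [simp]: "submod K (vecs K b)"
  by (auto simp: submod_def vecs_def)

lemma vecs_mono: "b \<le> b' \<Longrightarrow> vecs K b \<subseteq> vecs K b'"
  by (auto simp: vecs_def)

lemma lincomb_mem:
  assumes "submod K M" "\<And>i. i < b \<Longrightarrow> g i \<in> M" "\<And>i. c i \<in> K"
  shows "lincomb b c g \<in> M"
  using assms(2)
proof (induction b)
  case 0
  show "lincomb 0 c g \<in> M" using submodD(1)[OF assms(1)] by simp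
next
  case (Suc b)
  have "lincomb b c g + scale (c b) (g b) \<in> M"
    using Suc assms(1,3) by (intro submodD) auto
  then show "lincomb (Suc b) c g \<in> M" by (simp only: lincomb_Suc)
qed

lemma linear_on_lincomb:
  assumes M: "submod K M" and f: "linear_on K M f" and "\<And>i. i < b \<Longrightarrow> g i \<in> M" "\<And>i. c i \<in> K"
  shows "f (lincomb b c g) = lincomb b c (\<lambda>i. f (g i))"
  using assms(3)
proof (induction b)
  case 0
  have "f (scale 0 0) = scale 0 (f 0)"
    using f submodD(1)[OF M] zero unfolding linear_on_def by blast
  then show "f (lincomb 0 c g) = lincomb 0 c (\<lambda>i. f (g i))" by simp
next
  case (Suc b)
  have "f (lincomb b c g + scale (c b) (g b)) = f (lincomb b c g) + scale (c b) (f (g b))"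
    using f Suc.prems assms(4) lincomb_mem[OF M, of b g c] submodD[OF M]
    unfolding linear_on_def by simp
  then show "f (lincomb (Suc b) c g) = lincomb (Suc b) c (\<lambda>i. f (g i))"
    using Suc by (simp add: lincomb_Suc)
qed

lemma submod_syz: "submod K N \<Longrightarrow> submod K (syz K b g N)"
  using submod_vecs[of b] by (simp add: submod_def syz_def lincomb_add lincomb_scale)

lemma resolvable_mono_Suc: "resolvable K n M N \<Longrightarrow> resolvable K (Suc n) M N"
proof (induction n arbitrary: M N)
  case 0
  then have "generates K 0 (\<lambda>_. 0) M N" "syz K 0 (\<lambda>_. 0) N \<subseteq> {0}"
    by (auto simp: generates_def vecs_0 syz_def)
  then show ?case unfolding resolvable.simps by blast
next
  case (Suc n)
  then obtain b g where "generates K b g M N" "resolvable K n (syz K b g N) {0}" by auto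
  then show ?case using Suc.IH[of "syz K b g N" "{0}"] unfolding resolvable.simps(2)[of K "Suc n"] by blast
qed

lemma resolvable_mono: "resolvable K n M N \<Longrightarrow> n \<le> m \<Longrightarrow> resolvable K m M N"
  by (induction m) (auto simp: le_Suc_eq dest: resolvable_mono_Suc simp del: resolvable.simps)

text \<open>
  Transport along a linear map \<open>f\<close> inducing an isomorphism \<open>M / N \<cong> M' / N'\<close>: images (in this lemma)
  and preimages (in the next one) of generators have the same syzygies.
\<close>

lemma resolvable_image:
  assumes M: "submod K M" and N': "submod K N'" and f: "linear_on K M f"
    and into: "\<And>x. x \<in> M \<Longrightarrow> f x \<in> M'"
    and onto: "\<And>y. y \<in> M' \<Longrightarrow> \<exists>x\<in>M. y - f x \<in> N'"
    and ker: "\<And>x. x \<in> M \<Longrightarrow> f x \<in> N' \<longleftrightarrow> x \<in> N"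
    and NM: "N \<subseteq> M" and res: "resolvable K n M N"
  shows "resolvable K n M' N'"
proof (cases n)
  case 0
  have "y \<in> N'" if "y \<in> M'" for y
  proof -
    obtain x where x: "x \<in> M" "y - f x \<in> N'" using onto \<open>y \<in> M'\<close> by blast
    then have "f x \<in> N'" using 0 res ker by auto
    then show ?thesis using submod_cong[OF N' x(2)] by simp
  qed
  then show ?thesis using 0 by auto
next
  case (Suc m)
  then obtain b g where g: "\<forall>i<b. g i \<in> M" "\<forall>x\<in>M. \<exists>c\<in>vecs K b. x - lincomb b c g \<in> N"
    and res': "resolvable K m (syz K b g N) {0}"
    using res by (auto simp: generates_def)
  let ?h = "\<lambda>i. f (g i)"
  have fl: "f (lincomb b c g) = lincomb b c ?h" and lM: "lincomb b c g \<in> M" if "c \<in> vecs K b" for c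
    using linear_on_lincomb[OF M f, of b g c] lincomb_mem[OF M, of b g c] g that
    by (auto simp: vecs_def)
  have diff: "f (x - y) = f x - f y" if "x \<in> M" "y \<in> M" for x y
  proof -
    have "f ((x - y) + y) = f (x - y) + f y"
      using f submodD(5)[OF M] that unfolding linear_on_def by blast
    then show ?thesis by simp
  qed
  have "generates K b ?h M' N'"
    unfolding generates_def
  proof (intro conjI ballI)
    show "\<forall>i<b. f (g i) \<in> M'" using g into by auto
    fix y assume "y \<in> M'"
    then obtain x where x: "x \<in> M" "y - f x \<in> N'" using onto by blast
    obtain c where c: "c \<in> vecs K b" "x - lincomb b c g \<in> N" using g x by blast
    then have "f (x - lincomb b c g) \<in> N'" using NM ker by auto
    then have "f x - lincomb b c ?h \<in> N'" using fl[OF c(1)] diff[OF x(1) lM[OF c(1)]] by simp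
    then have "y - lincomb b c ?h \<in> N'" using submodD(2)[OF N' x(2)] by fastforce
    then show "\<exists>c\<in>vecs K b. y - lincomb b c ?h \<in> N'" using c by blast
  qed
  moreover have "lincomb b c ?h \<in> N' \<longleftrightarrow> lincomb b c g \<in> N" if "c \<in> vecs K b" for c
    using fl[OF that] lM[OF that] ker by metis
  then have "syz K b ?h N' = syz K b g N" by (auto simp: syz_def)
  ultimately show ?thesis unfolding Suc resolvable.simps using res' by metis
qed

lemma resolvable_preimage:
  assumes M: "submod K M" and N': "submod K N'" and f: "linear_on K M f"
    and into: "\<And>x. x \<in> M \<Longrightarrow> f x \<in> M'"
    and onto: "\<And>y. y \<in> M' \<Longrightarrow> \<exists>x\<in>M. y - f x \<in> N'"
    and ker: "\<And>x. x \<in> M \<Longrightarrow> f x \<in> N' \<longleftrightarrow> x \<in> N"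
    and res: "resolvable K n M' N'"
  shows "resolvable K n M N"
proof (cases n)
  case 0
  then show ?thesis using into ker res by auto
next
  case (Suc m)
  then obtain b h where h: "\<forall>i<b. h i \<in> M'" "\<forall>x\<in>M'. \<exists>c\<in>vecs K b. x - lincomb b c h \<in> N'"
    and res': "resolvable K m (syz K b h N') {0}"
    using res by (auto simp: generates_def)
  have "\<forall>i. \<exists>x. i < b \<longrightarrow> x \<in> M \<and> h i - f x \<in> N'" using h onto by blast
  then obtain g where g: "\<And>i. i < b \<Longrightarrow> g i \<in> M" "\<And>i. i < b \<Longrightarrow> h i - f (g i) \<in> N'" by metis
  have fl: "f (lincomb b c g) = lincomb b c (\<lambda>i. f (g i))" and lM: "lincomb b c g \<in> M"
    and near: "lincomb b c h - f (lincomb b c g) \<in> N'" if "c \<in> vecs K b" for c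
  proof -
    have cK: "\<And>i. c i \<in> K" using that by (simp add: vecs_def)
    show fl: "f (lincomb b c g) = lincomb b c (\<lambda>i. f (g i))" and "lincomb b c g \<in> M"
      using linear_on_lincomb[OF M f, of b g c] lincomb_mem[OF M, of b g c] g cK by auto
    show "lincomb b c h - f (lincomb b c g) \<in> N'"
      unfolding fl lincomb_diff_gens by (rule lincomb_mem[OF N']) (use g cK in auto)
  qed
  have diff: "f (x - y) = f x - f y" if "x \<in> M" "y \<in> M" for x y
  proof -
    have "f ((x - y) + y) = f (x - y) + f y"
      using f submodD(5)[OF M] that unfolding linear_on_def by blast
    then show ?thesis by simp
  qed
  have "generates K b g M N"
    unfolding generates_def
  proof (intro conjI ballI)
    show "\<forall>i<b. g i \<in> M" using g by auto
    fix x assume x: "x \<in> M"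
    then obtain c where c: "c \<in> vecs K b" "f x - lincomb b c h \<in> N'" using h into by blast
    then have "f x - f (lincomb b c g) \<in> N'" using submodD(2)[OF N' c(2) near[OF c(1)]] by simp
    then have "f (x - lincomb b c g) \<in> N'" using diff[OF x lM[OF c(1)]] by simp
    then have "x - lincomb b c g \<in> N" using ker submodD(5)[OF M x lM[OF c(1)]] by blast
    then show "\<exists>c\<in>vecs K b. x - lincomb b c g \<in> N" using c by blast
  qed
  moreover have "syz K b g N = syz K b h N'"
    using lM ker submod_cong[OF N' near] by (auto simp: syz_def)
  ultimately show ?thesis unfolding Suc resolvable.simps using res' by metis
qed

text \<open>
  Horseshoe lemma: if \<open>L / N\<close> and \<open>M / L\<close> have resolutions by \<open>n\<close> free modules, so has \<open>M / N\<close>. Generators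
  \<open>g\<close> of \<open>L / N\<close> followed by generators \<open>h\<close> of \<open>M / L\<close> generate \<open>M / N\<close>. Cutting off the first \<open>b\<close>
  coordinates maps the syzygies of the joint system onto those of \<open>h\<close>, with kernel the syzygies of \<open>g\<close>,
  so the syzygies form an extension of the same shape and induction applies.
\<close>

lemma resolvable_extension:
  assumes "submod K N" "submod K L" "submod K M" "N \<subseteq> L" "L \<subseteq> M"
    and "resolvable K n L N" "resolvable K n M L"
  shows "resolvable K n M N"
  using assms
proof (induction n arbitrary: M L N)
  case 0
  then show ?case by auto
next
  case (Suc n)
  note N = \<open>submod K N\<close> and L = \<open>submod K L\<close> and M = \<open>submod K M\<close>
  obtain b g where g: "generates K b g L N" and rg: "resolvable K n (syz K b g N) {0}"
    using Suc.prems by auto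
  obtain b' h where h: "generates K b' h M L" and rh: "resolvable K n (syz K b' h L) {0}"
    using Suc.prems by auto
  define k where "k = (\<lambda>i. if i < b then g i else h (i - b))"
  define shift where "shift = (\<lambda>(c :: nat \<Rightarrow> 'r) i. c (b + i))"
  define join where "join = (\<lambda>(c :: nat \<Rightarrow> 'r) d i. if i < b then c i else d (i - b))"
  have lk: "lincomb (b + b') c k = lincomb b c g + lincomb b' (shift c) h" for c
    unfolding k_def shift_def by (rule lincomb_append)
  have join: "join c d \<in> vecs K (b + b')"
      "lincomb (b + b') (join c d) k = lincomb b c g + lincomb b' d h"
      "shift (join c d) = d"
    if "c \<in> vecs K b" "d \<in> vecs K b'" for c d
  proof -
    show "join c d \<in> vecs K (b + b')" using that by (auto simp: join_def vecs_def)
    show s: "shift (join c d) = d" by (auto simp: join_def shift_def)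
    have "lincomb b (join c d) g = lincomb b c g" by (auto intro: lincomb_cong simp: join_def)
    then show "lincomb (b + b') (join c d) k = lincomb b c g + lincomb b' d h"
      by (simp add: lk s)
  qed
  have gL: "lincomb b c g \<in> L" if "c \<in> vecs K (b + b')" for c
    by (rule lincomb_mem[OF L]) (use that g in \<open>auto simp: vecs_def generates_def\<close>)
  have kgen: "generates K (b + b') k M N"
    unfolding generates_def
  proof (intro conjI ballI)
    show "\<forall>i<b + b'. k i \<in> M"
      using g h \<open>L \<subseteq> M\<close> by (auto simp: k_def generates_def)
    fix x assume "x \<in> M"
    then obtain d where d: "d \<in> vecs K b'" "x - lincomb b' d h \<in> L"
      using h by (auto simp: generates_def)
    then obtain c where c: "c \<in> vecs K b" "x - lincomb b' d h - lincomb b c g \<in> N"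
      using g by (auto simp: generates_def)
    then have "x - lincomb (b + b') (join c d) k \<in> N"
      using join(2)[OF c(1) d(1)] by (simp add: algebra_simps)
    then show "\<exists>c\<in>vecs K (b + b'). x - lincomb (b + b') c k \<in> N" using join(1)[OF c(1) d(1)] by blast
  qed
  let ?S = "syz K (b + b') k N"
  have S: "submod K ?S" by (rule submod_syz[OF N])
  have gS: "syz K b g N \<subseteq> ?S"
  proof
    fix c assume c: "c \<in> syz K b g N"
    then have "shift c = 0" by (auto simp: syz_def vecs_def shift_def fun_eq_iff)
    then show "c \<in> ?S" using c vecs_mono[of b "b + b'"] by (auto simp: syz_def lk)
  qed
  have "resolvable K n ?S (syz K b g N)"
  proof (rule resolvable_preimage[where f = shift and M' = "syz K b' h L" and N' = "{0}"])
    show "submod K ?S" "submod K {0}" "resolvable K n (syz K b' h L) {0}" by (fact S, simp, fact rh)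
    show "linear_on K ?S shift" by (auto simp: linear_on_def shift_def fun_eq_iff)
  next
    fix c assume c: "c \<in> ?S"
    then have cv: "c \<in> vecs K (b + b')" and "lincomb b c g + lincomb b' (shift c) h \<in> N"
      by (auto simp: syz_def lk)
    then have "lincomb b' (shift c) h - (- lincomb b c g) \<in> L"
      using \<open>N \<subseteq> L\<close> by (auto simp: add.commute)
    then have "lincomb b' (shift c) h \<in> L" using submod_cong[OF L] submodD(4)[OF L gL[OF cv]] by blast
    moreover have "shift c \<in> vecs K b'" using cv by (auto simp: vecs_def shift_def)
    ultimately show "shift c \<in> syz K b' h L" by (simp add: syz_def)
    have "shift c = 0 \<longleftrightarrow> c \<in> vecs K b"
    proof
      assume "shift c = 0"
      then have "c (b + i) = 0" for i by (auto simp: shift_def fun_eq_iff)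
      then show "c \<in> vecs K b" using cv by (auto simp: vecs_def le_iff_add)
    qed (auto simp: vecs_def shift_def fun_eq_iff)
    then show "shift c \<in> {0} \<longleftrightarrow> c \<in> syz K b g N"
      using c by (auto simp: syz_def lk)
  next
    fix d assume d: "d \<in> syz K b' h L"
    then have dv: "d \<in> vecs K b'" and "lincomb b' d h \<in> L" by (auto simp: syz_def)
    then obtain c where c: "c \<in> vecs K b" "lincomb b' d h - lincomb b c g \<in> N"
      using g by (auto simp: generates_def)
    have mc: "- c \<in> vecs K b" by (rule submodD(4)[OF submod_vecs c(1)])
    \<comment> \<open>A syzygy of \<open>h\<close> modulo \<open>L\<close> holds modulo \<open>N\<close> up to a combination of the \<open>g i\<close>.\<close>
    have "join (- c) d \<in> ?S"
      using join[OF mc dv] c(2) by (auto simp: syz_def lincomb_uminus)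
    moreover have "d - shift (join (- c) d) = 0" using join(3)[OF mc dv] by simp
    ultimately show "\<exists>x\<in>?S. d - shift x \<in> {0}" by blast
  qed
  then have "resolvable K n ?S {0}"
    using Suc.IH[of "{0}" "syz K b g N" ?S] S submod_syz[OF N] gS rg submodD(1)[OF submod_syz[OF N]]
    by simp
  then show ?case unfolding resolvable.simps using kgen by blast
qed

text \<open>
  This is the bound \<open>pd (M / L) \<le> max (pd (M / N)) (pd (L / N) + 1)\<close>, usually proved by a mapping cone.
  Here generators of \<open>M / N\<close> also generate \<open>M / L\<close>, and the syzygies modulo \<open>L\<close> extend \<open>L / N\<close> by the
  syzygies modulo \<open>N\<close>, to which the horseshoe lemma applies.
\<close>

lemma resolvable_quotient:
  assumes N: "submod K N" and L: "submod K L" and M: "submod K M" and "N \<subseteq> L" "L \<subseteq> M"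
    and LN: "resolvable K n L N" and MN: "resolvable K (Suc n) M N"
  shows "resolvable K (Suc n) M L"
proof -
  obtain b g where g: "generates K b g M N" and rg: "resolvable K n (syz K b g N) {0}"
    using MN unfolding resolvable.simps by blast
  have gL: "generates K b g M L" using g \<open>N \<subseteq> L\<close> unfolding generates_def by blast
  have "resolvable K n (syz K b g L) (syz K b g N)"
  proof (rule resolvable_preimage[where f = "\<lambda>c. lincomb b c g" and M' = L and N' = N])
    show "linear_on K (syz K b g L) (\<lambda>c. lincomb b c g)"
      by (simp add: linear_on_def lincomb_add lincomb_scale)
    show "\<exists>c\<in>syz K b g L. y - lincomb b c g \<in> N" if "y \<in> L" for y
    proof -
      have "\<forall>x\<in>M. \<exists>c\<in>vecs K b. x - lincomb b c g \<in> N" "y \<in> M"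
        using g that \<open>L \<subseteq> M\<close> by (auto simp only: generates_def)
      then obtain c where c: "c \<in> vecs K b" "y - lincomb b c g \<in> N" by metis
      then have "lincomb b c g \<in> L"
        using submod_cong[OF L, of y "lincomb b c g"] that \<open>N \<subseteq> L\<close> by blast
      then show ?thesis using c by (auto simp: syz_def)
    qed
    show "lincomb b c g \<in> L" "lincomb b c g \<in> N \<longleftrightarrow> c \<in> syz K b g N"
      if "c \<in> syz K b g L" for c
      using that by (simp_all add: syz_def)
  qed (fact submod_syz[OF L] N LN)+
  moreover have "syz K b g N \<subseteq> syz K b g L" using \<open>N \<subseteq> L\<close> by (auto simp: syz_def)
  ultimately have "resolvable K n (syz K b g L) {0}"
    using submodD(1)[OF submod_syz[OF N, of b g]] rg
    by (intro resolvable_extension[OF submod_zero submod_syz[OF N] submod_syz[OF L]]) blast+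
  then show ?thesis unfolding resolvable.simps using gL by blast
qed

end

section \<open>Quotients by squarefree monomial ideals\<close>

definition supported :: "'v set \<Rightarrow> (('v \<Rightarrow>\<^sub>0 nat) \<Rightarrow>\<^sub>0 'k::field) set"
where
  "supported V = {f. \<forall>m\<in>Poly_Mapping.keys f. Poly_Mapping.keys m \<subseteq> V}"

text \<open>
  The squarefree monomial ideal whose monomials are those with support in the up-closed family \<open>U\<close>,
  placed in the first coordinate of the free module of rank one. Describing the ideal by a family of
  supports makes the ideal operations of the proof set-theoretic: adding \<open>x\<^sub>v\<close> to the ideal gives the family
  \<open>{s. v \<in> s \<or> s \<in> U}\<close>, and the colon ideal by \<open>x\<^sub>v\<close> has the family \<open>{s. insert v s \<in> U}\<close>.
\<close>

definition monomial_vecs :: "'v set \<Rightarrow> 'v set set \<Rightarrow> (nat \<Rightarrow> ('v \<Rightarrow>\<^sub>0 nat) \<Rightarrow>\<^sub>0 'k::field) set"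
where
  "monomial_vecs V U =
     {c \<in> vecs (supported V) 1. \<forall>m\<in>Poly_Mapping.keys (c 0). Poly_Mapping.keys m \<in> U}"

definition up_closed :: "'v set set \<Rightarrow> bool"
where
  "up_closed U \<longleftrightarrow> (\<forall>s\<in>U. \<forall>t. s \<subseteq> t \<longrightarrow> t \<in> U)"

text \<open>
  The cyclic module \<open>S / I\<close>, with \<open>I\<close> the ideal of the family \<open>U\<close>, has a resolution by \<open>n\<close> free modules.
\<close>

definition quotient_resolvable :: "'k::field itself \<Rightarrow> 'v set \<Rightarrow> nat \<Rightarrow> 'v set set \<Rightarrow> bool"
where
  "quotient_resolvable k V n U \<longleftrightarrow>
     resolvable (supported V :: (('v \<Rightarrow>\<^sub>0 nat) \<Rightarrow>\<^sub>0 'k) set) n (vecs (supported V) 1) (monomial_vecs V U)"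

lemma keys_add_nat: "Poly_Mapping.keys (a + b) = Poly_Mapping.keys a \<union> Poly_Mapping.keys (b :: 'v \<Rightarrow>\<^sub>0 nat)"
  by (auto simp: in_keys_iff lookup_add)

lemma supported_coefficients:
  "coefficients (supported V :: (('v \<Rightarrow>\<^sub>0 nat) \<Rightarrow>\<^sub>0 'k::field) set)"
proof
  fix a b :: "('v \<Rightarrow>\<^sub>0 nat) \<Rightarrow>\<^sub>0 'k"
  assume ab: "a \<in> supported V" "b \<in> supported V"
  show "a + b \<in> supported V"
    using ab Poly_Mapping.keys_add[of a b] by (auto simp: supported_def)
  show "a * b \<in> supported V"
    using ab Poly_Mapping.keys_mult[of a b] by (fastforce simp: supported_def keys_add_nat)
next
  fix a :: "('v \<Rightarrow>\<^sub>0 nat) \<Rightarrow>\<^sub>0 'k"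
  show "a \<in> supported V \<Longrightarrow> - a \<in> supported V"
    by (simp add: supported_def in_keys_iff)
qed (simp_all add: supported_def)

interpretation supported: coefficients "supported V"
  by (rule supported_coefficients)

lemma submod_monomial_vecs:
  assumes "up_closed U"
  shows "submod (supported V) (monomial_vecs V U :: (nat \<Rightarrow> ('v \<Rightarrow>\<^sub>0 nat) \<Rightarrow>\<^sub>0 'k::field) set)"
  unfolding submod_def
proof (intro conjI ballI)
  show "0 \<in> monomial_vecs V U" by (simp add: monomial_vecs_def vecs_def)
next
  fix x y :: "nat \<Rightarrow> ('v \<Rightarrow>\<^sub>0 nat) \<Rightarrow>\<^sub>0 'k"
  assume "x \<in> monomial_vecs V U" "y \<in> monomial_vecs V U"
  then show "x + y \<in> monomial_vecs V U"
    using Poly_Mapping.keys_add[of "x 0" "y 0"] by (auto simp: monomial_vecs_def vecs_def)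
next
  fix a :: "('v \<Rightarrow>\<^sub>0 nat) \<Rightarrow>\<^sub>0 'k" and x :: "nat \<Rightarrow> ('v \<Rightarrow>\<^sub>0 nat) \<Rightarrow>\<^sub>0 'k"
  assume a: "a \<in> supported V" and x: "x \<in> monomial_vecs V U"
  have "Poly_Mapping.keys m \<in> U" if m: "m \<in> Poly_Mapping.keys (a * x 0)" for m
  proof -
    obtain p q where "m = p + q" "q \<in> Poly_Mapping.keys (x 0)"
      using m Poly_Mapping.keys_mult[of a "x 0"] by blast
    then show ?thesis using x assms by (auto simp: monomial_vecs_def up_closed_def keys_add_nat)
  qed
  then show "scale a x \<in> monomial_vecs V U"
    using a x by (auto simp: monomial_vecs_def vecs_def)
qed

lemma sum_monomials:
  "(\<Sum>m\<in>Poly_Mapping.keys f. Poly_Mapping.single m (Poly_Mapping.lookup f m)) = f"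
  by (rule poly_mapping_eqI) (auto simp: lookup_sum lookup_single when_def in_keys_iff)

text \<open>
  Addition of exponents is injective, so the terms of the product do not cancel.
\<close>

lemma keys_monomial_times:
  fixes e :: "'v \<Rightarrow>\<^sub>0 nat" and f :: "('v \<Rightarrow>\<^sub>0 nat) \<Rightarrow>\<^sub>0 'k::field"
  shows "Poly_Mapping.keys (Poly_Mapping.single e 1 * f) = (+) e ` Poly_Mapping.keys f"
proof
  have "Poly_Mapping.lookup (Poly_Mapping.single e 1 * f) (e + m) = Poly_Mapping.lookup f m" for m
  proof -
    have "Poly_Mapping.single e 1 * f =
        (\<Sum>l\<in>Poly_Mapping.keys f. Poly_Mapping.single (e + l) (Poly_Mapping.lookup f l))"
      by (subst (1) sum_monomials[of f, symmetric]) (simp add: sum_distrib_left mult_single)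
    then show ?thesis by (simp add: lookup_sum lookup_single when_def in_keys_iff)
  qed
  then show "(+) e ` Poly_Mapping.keys f \<subseteq> Poly_Mapping.keys (Poly_Mapping.single e 1 * f)"
    by (auto simp: in_keys_iff)
  show "Poly_Mapping.keys (Poly_Mapping.single e 1 * f) \<subseteq> (+) e ` Poly_Mapping.keys f"
    using Poly_Mapping.keys_mult[of "Poly_Mapping.single e 1" f] by auto
qed

text \<open>
  The monomials divisible by \<open>x\<^sub>v\<close> make up the first summand, the others the second.
\<close>

lemma split_variable:
  fixes f :: "('v \<Rightarrow>\<^sub>0 nat) \<Rightarrow>\<^sub>0 'k::field"
  assumes "f \<in> supported V"
  obtains p q where "p \<in> supported V" "q \<in> supported V" "f = variable v * p + q"
    "\<And>m. m \<in> Poly_Mapping.keys q \<Longrightarrow> m \<in> Poly_Mapping.keys f \<and> v \<notin> Poly_Mapping.keys m"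
proof -
  let ?t = "\<lambda>m. Poly_Mapping.single m (Poly_Mapping.lookup f m)"
  let ?x = "Poly_Mapping.single v (1::nat)"
  let ?A = "{m \<in> Poly_Mapping.keys f. v \<in> Poly_Mapping.keys m}"
  let ?B = "{m \<in> Poly_Mapping.keys f. v \<notin> Poly_Mapping.keys m}"
  define p where "p = (\<Sum>m\<in>?A. Poly_Mapping.single (m - ?x) (Poly_Mapping.lookup f m))"
  define q where "q = (\<Sum>m\<in>?B. ?t m)"
  have q: "Poly_Mapping.keys q \<subseteq> ?B"
    unfolding q_def by (rule order_trans[OF Poly_Mapping.keys_sum]) auto
  have p: "Poly_Mapping.keys p \<subseteq> (\<lambda>m. m - ?x) ` ?A"
    unfolding p_def by (rule order_trans[OF Poly_Mapping.keys_sum]) auto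
  have div: "?x + (m - ?x) = m" if "v \<in> Poly_Mapping.keys m" for m :: "'v \<Rightarrow>\<^sub>0 nat"
    using that by (intro poly_mapping_eqI) (auto simp: lookup_add lookup_minus lookup_single when_def in_keys_iff)
  have "Poly_Mapping.keys (m - ?x) \<subseteq> V" if "m \<in> ?A" for m
  proof -
    have "Poly_Mapping.keys (m - ?x) \<subseteq> Poly_Mapping.keys m"
      by (auto simp: in_keys_iff lookup_minus)
    also have "\<dots> \<subseteq> V" using that assms by (auto simp: supported_def)
    finally show ?thesis .
  qed
  then have "p \<in> supported V" using p unfolding supported_def by blast
  moreover have "q \<in> supported V" using q assms by (auto simp: supported_def)
  moreover have "f = variable v * p + q"
  proof -
    have "variable v * p = (\<Sum>m\<in>?A. ?t m)"
      unfolding variable_def p_def sum_distrib_left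
      by (rule sum.cong) (auto simp: mult_single div simp del: One_nat_def)
    moreover have "(\<Sum>m\<in>?A. ?t m) + (\<Sum>m\<in>?B. ?t m) = (\<Sum>m\<in>?A \<union> ?B. ?t m)"
      by (rule sum.union_disjoint[symmetric]) auto
    moreover have "?A \<union> ?B = Poly_Mapping.keys f" by blast
    ultimately show ?thesis by (simp add: q_def sum_monomials)
  qed
  ultimately show ?thesis using that q by blast
qed

lemma monomial_vecs_subset: "monomial_vecs V U \<subseteq> vecs (supported V) 1"
  by (auto simp: monomial_vecs_def)

text \<open>
  Multiplication by \<open>x\<^sub>v\<close> is an isomorphism \<open>S / (I : x\<^sub>v) \<cong> (I + (x\<^sub>v)) / I\<close>.
\<close>

lemma resolvable_variable_layer:
  assumes U: "up_closed U" and v: "v \<in> V"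
    and colon: "quotient_resolvable TYPE('k::field) V n {s. insert v s \<in> U}"
  shows "resolvable (supported V) n (monomial_vecs V {s. v \<in> s \<or> s \<in> U}) (monomial_vecs V U :: (nat \<Rightarrow> _ \<Rightarrow>\<^sub>0 'k) set)"
proof (rule supported.resolvable_image[where f = "scale (variable v)" and M = "vecs (supported V) 1"])
  let ?W = "monomial_vecs V {s. v \<in> s \<or> s \<in> U} :: (nat \<Rightarrow> _ \<Rightarrow>\<^sub>0 'k) set"
  have xV: "variable v \<in> (supported V :: (_ \<Rightarrow>\<^sub>0 'k) set)" using v by (simp add: supported_def variable_def)
  have keys: "Poly_Mapping.keys (variable v * f) = (+) (Poly_Mapping.single v 1) ` Poly_Mapping.keys f"
    for f :: "_ \<Rightarrow>\<^sub>0 'k"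
    unfolding variable_def by (rule keys_monomial_times)
  show "linear_on (supported V) (vecs (supported V) 1) (scale (variable v :: _ \<Rightarrow>\<^sub>0 'k))"
    by (auto simp: linear_on_def scale_def algebra_simps)
  fix c :: "nat \<Rightarrow> _ \<Rightarrow>\<^sub>0 'k"
  assume c: "c \<in> vecs (supported V) 1"
  then have sc: "scale (variable v) c \<in> vecs (supported V) 1"
    by (intro supported.submodD(3)[OF supported.submod_vecs xV])
  then show "scale (variable v) c \<in> ?W"
    by (auto simp: monomial_vecs_def keys keys_add_nat)
  show "scale (variable v) c \<in> monomial_vecs V U \<longleftrightarrow> c \<in> monomial_vecs V {s. insert v s \<in> U}"
    using c sc by (auto simp: monomial_vecs_def keys keys_add_nat)
next
  fix y :: "nat \<Rightarrow> _ \<Rightarrow>\<^sub>0 'k"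
  assume y: "y \<in> monomial_vecs V {s. v \<in> s \<or> s \<in> U}"
  then have "y 0 \<in> supported V" by (simp add: monomial_vecs_def vecs_def)
  then obtain p q where pq: "p \<in> supported V" "q \<in> supported V" "y 0 = variable v * p + q"
    "\<And>m. m \<in> Poly_Mapping.keys q \<Longrightarrow> m \<in> Poly_Mapping.keys (y 0) \<and> v \<notin> Poly_Mapping.keys m"
    using split_variable[of "y 0" V v] by blast
  let ?c = "\<lambda>i. if i = (0::nat) then p else 0"
  let ?d = "\<lambda>i. if i = (0::nat) then q else 0"
  have "y - scale (variable v) ?c = ?d"
    using pq(3) y by (auto simp: fun_eq_iff monomial_vecs_def vecs_def)
  moreover have "?d \<in> monomial_vecs V U"
    using pq y by (auto simp: monomial_vecs_def vecs_def)
  ultimately have "y - scale (variable v) ?c \<in> monomial_vecs V U" by simp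
  moreover have "?c \<in> vecs (supported V) 1" using pq by (simp add: vecs_def)
  ultimately show "\<exists>x\<in>vecs (supported V) 1. y - scale (variable v) x \<in> monomial_vecs V U" by blast
next
  show "resolvable (supported V) n (vecs (supported V) 1)
      (monomial_vecs V {s. insert v s \<in> U} :: (nat \<Rightarrow> _ \<Rightarrow>\<^sub>0 'k) set)"
    using colon by (simp add: quotient_resolvable_def)
qed (simp_all add: submod_monomial_vecs[OF U] monomial_vecs_subset del: One_nat_def)

lemma up_closed_variable: "up_closed U \<Longrightarrow> up_closed {s. v \<in> s \<or> s \<in> U}"
  by (auto simp: up_closed_def)

lemma monomial_vecs_mono: "U \<subseteq> U' \<Longrightarrow> monomial_vecs V U \<subseteq> monomial_vecs V U'"
  by (auto simp: monomial_vecs_def)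

text \<open>
  From \<open>0 \<rightarrow> S / (I : x\<^sub>v) \<rightarrow> S / I \<rightarrow> S / (I + (x\<^sub>v)) \<rightarrow> 0\<close>.
\<close>

lemma quotient_resolvable_colon_sum:
  assumes U: "up_closed U" and v: "v \<in> V"
    and colon: "quotient_resolvable TYPE('k::field) V n {s. insert v s \<in> U}"
    and sum: "quotient_resolvable TYPE('k) V n {s. v \<in> s \<or> s \<in> U}"
  shows "quotient_resolvable TYPE('k) V n U"
  unfolding quotient_resolvable_def
proof (rule supported.resolvable_extension[where L = "monomial_vecs V {s. v \<in> s \<or> s \<in> U}"])
  show "monomial_vecs V U \<subseteq> (monomial_vecs V {s. v \<in> s \<or> s \<in> U} :: (nat \<Rightarrow> _ \<Rightarrow>\<^sub>0 'k) set)"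
    by (rule monomial_vecs_mono) auto
qed (use assms in \<open>simp_all add: submod_monomial_vecs up_closed_variable monomial_vecs_subset
    resolvable_variable_layer quotient_resolvable_def del: One_nat_def\<close>)

text \<open>
  If no minimal generator of \<open>I\<close> involves \<open>x\<^sub>v\<close>, then \<open>x\<^sub>v\<close> is a nonzerodivisor on \<open>S / I\<close>, and dividing by
  it raises the projective dimension by at most one.
\<close>

lemma quotient_resolvable_variable:
  assumes U: "up_closed U" and v: "v \<in> V" and free: "\<And>s. insert v s \<in> U \<Longrightarrow> s \<in> U"
    and res: "quotient_resolvable TYPE('k::field) V n U"
  shows "quotient_resolvable TYPE('k) V (Suc n) {s. v \<in> s \<or> s \<in> U}"
proof -
  have "{s. insert v s \<in> U} = U" using U free unfolding up_closed_def by blast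
  then have "quotient_resolvable TYPE('k) V n {s. insert v s \<in> U}" using res by (simp only:)
  then have layer: "resolvable (supported V) n (monomial_vecs V {s. v \<in> s \<or> s \<in> U})
      (monomial_vecs V U :: (nat \<Rightarrow> _ \<Rightarrow>\<^sub>0 'k) set)"
    by (rule resolvable_variable_layer[OF U v])
  show ?thesis
    unfolding quotient_resolvable_def
  proof (rule supported.resolvable_quotient[OF _ _ _ _ _ layer])
    show "monomial_vecs V U \<subseteq> (monomial_vecs V {s. v \<in> s \<or> s \<in> U} :: (nat \<Rightarrow> _ \<Rightarrow>\<^sub>0 'k) set)"
      by (rule monomial_vecs_mono) auto
    show "resolvable (supported V) (Suc n) (vecs (supported V) 1)
        (monomial_vecs V U :: (nat \<Rightarrow> _ \<Rightarrow>\<^sub>0 'k) set)"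
      using res unfolding quotient_resolvable_def by (rule supported.resolvable_mono_Suc)
  qed (rule submod_monomial_vecs[OF U] submod_monomial_vecs[OF up_closed_variable[OF U]]
        supported.submod_vecs monomial_vecs_subset)+
qed

lemma quotient_resolvable_variables:
  assumes "finite A" "A \<subseteq> V" and U: "up_closed U"
    and free: "\<And>s. s \<union> A \<in> U \<Longrightarrow> s \<in> U"
    and res: "quotient_resolvable TYPE('k::field) V n U"
  shows "quotient_resolvable TYPE('k) V (n + card A) {s. A \<inter> s \<noteq> {} \<or> s \<in> U}"
  using assms(1,2) free
proof (induction A)
  case empty
  then show ?case using res by simp
next
  case (insert a A)
  let ?U = "{s. A \<inter> s \<noteq> {} \<or> s \<in> U}"
  have free: "s \<in> U" if "s \<union> B \<in> U" "B \<subseteq> insert a A" for s B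
  proof -
    have "s \<union> insert a A \<in> U" using that U unfolding up_closed_def by (meson Un_mono order_refl)
    then show ?thesis using insert.prems by blast
  qed
  have "quotient_resolvable TYPE('k) V (Suc (n + card A)) {s. a \<in> s \<or> s \<in> ?U}"
  proof (rule quotient_resolvable_variable)
    show "up_closed ?U" using U by (fastforce simp: up_closed_def)
    show "s \<in> ?U" if "insert a s \<in> ?U" for s
      using that free[of s "{a}"] \<open>a \<notin> A\<close> by auto
    show "quotient_resolvable TYPE('k) V (n + card A) ?U"
      using insert.prems free by (intro insert.IH) (blast, blast)
  qed (use insert.prems in auto)
  moreover have "{s. a \<in> s \<or> s \<in> ?U} = {s. insert a A \<inter> s \<noteq> {} \<or> s \<in> U}" by auto
  ultimately show ?case using insert.hyps by simp
qed

lemma quotient_resolvable_mono: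
  "quotient_resolvable k V n U \<Longrightarrow> n \<le> m \<Longrightarrow> quotient_resolvable k V m U"
  unfolding quotient_resolvable_def by (rule supported.resolvable_mono)

lemma quotient_resolvable_UNIV: "quotient_resolvable k V n UNIV"
  by (rule quotient_resolvable_mono[of k V 0]) (auto simp: quotient_resolvable_def monomial_vecs_def)

lemma quotient_resolvable_empty: "quotient_resolvable TYPE('k::field) V (Suc n) {}"
proof (rule quotient_resolvable_mono)
  let ?K = "supported V :: (_ \<Rightarrow>\<^sub>0 'k) set"
  let ?g = "\<lambda>_ i. if i = (0::nat) then 1 else (0 :: _ \<Rightarrow>\<^sub>0 'k)"
  have J: "monomial_vecs V {} = {0 :: nat \<Rightarrow> _ \<Rightarrow>\<^sub>0 'k}"
  proof -
    have "c = 0" if "c \<in> vecs ?K 1" "Poly_Mapping.keys (c 0) = {}" for c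
    proof
      fix i show "c i = 0 i" using that by (cases i) (auto simp: vecs_def)
    qed
    then show ?thesis by (auto simp: monomial_vecs_def vecs_def)
  qed
  have id: "lincomb 1 c ?g = c" if "c \<in> vecs ?K 1" for c
    using that by (auto simp: lincomb_def vecs_def fun_eq_iff)
  have "generates ?K 1 ?g (vecs ?K 1) {0}"
    unfolding generates_def
  proof (intro conjI ballI)
    show "\<forall>i<1. ?g i \<in> vecs ?K 1" by (auto simp: vecs_def)
    show "\<exists>c\<in>vecs ?K 1. x - lincomb 1 c ?g \<in> {0}" if "x \<in> vecs ?K 1" for x
      using id[OF that] that by (intro bexI[of _ x]) auto
  qed
  moreover have "syz ?K 1 ?g {0} \<subseteq> {0}" using id by (auto simp: syz_def)
  ultimately have "resolvable ?K (Suc 0) (vecs ?K 1) (monomial_vecs V {})"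
    unfolding J resolvable.simps by blast
  then show "quotient_resolvable TYPE('k) V (Suc 0) {}" unfolding quotient_resolvable_def .
qed simp

section \<open>Domination after deleting and contracting vertices\<close>

text \<open>
  Edgewise dominance without its ambient vertex set. A vertex lying in an edge of \<open>F\<close> and a vertex
  having a neighbor in an edge of \<open>F\<close> are the same case here: some edge through the vertex meets an
  edge of \<open>F\<close>.
\<close>

definition dominant :: "'v set set \<Rightarrow> 'v set set \<Rightarrow> bool"
where
  "dominant E F \<longleftrightarrow> F \<subseteq> E \<and> (\<forall>v\<in>\<Union>E. {v} \<in> E \<or> (\<exists>e\<in>E. v \<in> e \<and> e \<inter> \<Union>F \<noteq> {}))"

definition antichain :: "'v set set \<Rightarrow> bool"
where
  "antichain E \<longleftrightarrow> (\<forall>e\<in>E. \<forall>e'\<in>E. e \<subseteq> e' \<longrightarrow> e = e')"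

definition minimals :: "'v set set \<Rightarrow> 'v set set"
where
  "minimals G = {e \<in> G. \<forall>e'\<in>G. e' \<subseteq> e \<longrightarrow> e = e'}"

definition up_closure :: "'v set set \<Rightarrow> 'v set set"
where
  "up_closure E = {s. \<exists>e\<in>E. e \<subseteq> s}"

lemma edgewise_dominant_iff:
  assumes "E \<subseteq> Pow V"
  shows "edgewise_dominant V E F \<longleftrightarrow> dominant E F"
proof -
  have triv: "(\<exists>e\<in>E. trivial_edge e \<and> v \<in> e) \<longleftrightarrow> {v} \<in> E" for v
    by (auto simp: trivial_edge_def card_1_singleton_iff)
  have "(\<exists>f\<in>F. v \<in> f) \<or> (\<exists>w\<in>V. neighbors E v w \<and> (\<exists>f\<in>F. w \<in> f)) \<longleftrightarrow>
      (\<exists>e\<in>E. v \<in> e \<and> e \<inter> \<Union>F \<noteq> {})" if "F \<subseteq> E" for v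
  proof
    assume "(\<exists>f\<in>F. v \<in> f) \<or> (\<exists>w\<in>V. neighbors E v w \<and> (\<exists>f\<in>F. w \<in> f))"
    then show "\<exists>e\<in>E. v \<in> e \<and> e \<inter> \<Union>F \<noteq> {}"
      using \<open>F \<subseteq> E\<close> unfolding neighbors_def by blast
  next
    assume "\<exists>e\<in>E. v \<in> e \<and> e \<inter> \<Union>F \<noteq> {}"
    then obtain e w f where "e \<in> E" "v \<in> e" "w \<in> e" "f \<in> F" "w \<in> f" by blast
    then show "(\<exists>f\<in>F. v \<in> f) \<or> (\<exists>w\<in>V. neighbors E v w \<and> (\<exists>f\<in>F. w \<in> f))"
      using assms unfolding neighbors_def by (cases "v = w") blast+
  qed
  note meets = this
  have verts: "(\<forall>v\<in>\<Union>E. P v) \<longleftrightarrow> (\<forall>v\<in>V. \<not> isolated E v \<longrightarrow> P v)" for P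
    using assms unfolding isolated_def by blast
  show ?thesis
  proof (cases "F \<subseteq> E")
    case True
    show ?thesis
      unfolding edgewise_dominant_def dominant_def triv verts meets[OF True, symmetric] by blast
  qed (simp add: edgewise_dominant_def dominant_def)
qed

lemma up_closed_up_closure: "up_closed (up_closure E)"
  by (auto simp: up_closed_def up_closure_def)

lemma antichain_minimals: "antichain (minimals G)"
  unfolding antichain_def minimals_def by blast

lemma up_closure_minimals:
  assumes "finite G"
  shows "up_closure (minimals G) = up_closure G"
proof
  show "up_closure G \<subseteq> up_closure (minimals G)"
  proof
    fix s assume "s \<in> up_closure G"
    then obtain g where g: "g \<in> G" "g \<subseteq> s" by (auto simp: up_closure_def)
    obtain m where m: "m \<in> G" "m \<subseteq> g" and min: "\<forall>b\<in>G. b \<subseteq> m \<longrightarrow> m = b"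
      using finite_has_minimal2[OF assms g(1)] by metis
    have "m \<in> minimals G" using m(1) min by (simp add: minimals_def)
    moreover have "m \<subseteq> s" using m(2) g(2) by (rule subset_trans)
    ultimately show "s \<in> up_closure (minimals G)" unfolding up_closure_def by blast
  qed
  show "up_closure (minimals G) \<subseteq> up_closure G"
    unfolding up_closure_def minimals_def by blast
qed

lemma dominant_exists:
  assumes "finite (\<Union>E)"
  obtains F where "dominant E F" "card F \<le> card (\<Union>E)"
proof -
  have "\<forall>v\<in>\<Union>E. \<exists>e. e \<in> E \<and> v \<in> e" by blast
  then obtain e where e: "\<And>v. v \<in> \<Union>E \<Longrightarrow> e v \<in> E \<and> v \<in> e v" by metis
  have "dominant E (e ` \<Union>E)"
    unfolding dominant_def
  proof (intro conjI ballI disjI2)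
    show "e ` \<Union>E \<subseteq> E" using e by blast
    fix v assume "v \<in> \<Union>E"
    then show "\<exists>f\<in>E. v \<in> f \<and> f \<inter> \<Union>(e ` \<Union>E) \<noteq> {}" using e by (intro bexI[of _ "e v"]) auto
  qed
  then show ?thesis using that card_image_le[OF assms] by blast
qed

text \<open>
  Think of \<open>E'\<close> as obtained from \<open>E\<close> by deleting the vertices in \<open>A\<close> (all of them
  neighbors of \<open>v\<close>) and possibly contracting \<open>c\<close>; in the process some vertices become isolated. A
  dominating family of \<open>E'\<close> lifts to \<open>E\<close> at the cost of one extra edge for each vertex that is lost but not
  in \<open>A\<close>. The point is that the vertices of \<open>A\<close> cost nothing: the edge chosen for the lost vertex \<open>c\<close> is
  \<open>e0\<close>, which contains \<open>v\<close> and so dominates every neighbor of \<open>v\<close>. It also dominates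
  each vertex \<open>u\<close> that has become trivial because \<open>{u, c}\<close> was an edge.
\<close>

lemma dominant_lift:
  assumes fin: "finite (\<Union>E)"
    and cover: "\<And>f. f \<in> E' \<Longrightarrow> \<exists>e\<in>E. f \<subseteq> e"
    and A: "A \<subseteq> \<Union>E" "A \<inter> \<Union>E' = {}" "\<And>a. a \<in> A \<Longrightarrow> \<exists>e\<in>E. a \<in> e \<and> v \<in> e"
    and c: "c \<in> \<Union>E" "c \<notin> \<Union>E'" "c \<notin> A" and e0: "e0 \<in> E" "c \<in> e0" "v \<in> e0"
    and triv: "\<And>u. {u} \<in> E' \<Longrightarrow> {u} \<in> E \<or> {u, c} \<in> E"
    and F': "dominant E' F'"
  shows "\<exists>F. dominant E F \<and> card F + card A + card (\<Union>E') \<le> card F' + card (\<Union>E)"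
proof -
  obtain l where l: "\<And>f. f \<in> E' \<Longrightarrow> l f \<in> E \<and> f \<subseteq> l f" using cover by metis
  have "\<forall>u\<in>\<Union>E. \<exists>e. e \<in> E \<and> u \<in> e" by blast
  then obtain p0 where p0: "\<And>u. u \<in> \<Union>E \<Longrightarrow> p0 u \<in> E \<and> u \<in> p0 u" by metis
  define p where "p = p0(c := e0)"
  have p: "p u \<in> E" "u \<in> p u" if "u \<in> \<Union>E" for u using p0[OF that] e0 by (auto simp: p_def)
  define X where "X = \<Union>E - \<Union>E' - A"
  define F where "F = l ` F' \<union> p ` X"
  have sub: "\<Union>E' \<subseteq> \<Union>E" using cover by blast
  have F'E': "F' \<subseteq> E'" using F' by (simp add: dominant_def)
  have "finite E'" using finite_subset[OF sub fin] by (rule finite_UnionD)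
  then have finF': "finite F'" using F'E' finite_subset by blast
  have cX: "c \<in> X" using c by (simp add: X_def)
  have touch: "u \<in> \<Union>F" if "u \<in> X" for u
    using that p[of u] by (auto simp: F_def X_def)
  have e0F: "e0 \<in> F" using cX by (force simp: F_def p_def)
  have "dominant E F"
    unfolding dominant_def
  proof (intro conjI ballI)
    show "F \<subseteq> E" using l p F'E' by (auto simp: F_def X_def)
    fix u assume u: "u \<in> \<Union>E"
    consider "u \<in> X" | "u \<in> A" | "u \<in> \<Union>E'" using u by (auto simp: X_def)
    then show "{u} \<in> E \<or> (\<exists>e\<in>E. u \<in> e \<and> e \<inter> \<Union>F \<noteq> {})"
    proof cases
      case 1
      then show ?thesis using p[OF u] touch[of u] by blast
    next
      case 2
      then obtain e where "e \<in> E" "u \<in> e" "v \<in> e" using A(3) by blast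
      moreover have "v \<in> \<Union>F" using e0(3) e0F by blast
      ultimately show ?thesis by blast
    next
      case 3
      then consider "{u} \<in> E'" | "\<exists>f\<in>E'. u \<in> f \<and> f \<inter> \<Union>F' \<noteq> {}"
        using F' unfolding dominant_def by blast
      then show ?thesis
      proof cases
        case 1
        then consider "{u} \<in> E" | "{u, c} \<in> E" using triv by blast
        then show ?thesis using touch[OF cX] by cases blast+
      next
        case 2
        then obtain f g w where "f \<in> E'" "u \<in> f" "g \<in> F'" "w \<in> f" "w \<in> g" by blast
        then have "l f \<in> E" "u \<in> l f" "w \<in> l f" and "w \<in> l g" "l g \<in> F"
          using l[of f] l[of g] F'E' unfolding F_def by blast+
        then show ?thesis by blast
      qed
    qed
  qed
  moreover have "card F + card A + card (\<Union>E') \<le> card F' + card (\<Union>E)"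
  proof -
    have finX: "finite X" and finA: "finite A" and finU: "finite (\<Union>E')"
      using fin finite_subset[OF A(1)] finite_subset[OF sub] by (simp_all add: X_def)
    have "card F \<le> card (l ` F') + card (p ` X)" unfolding F_def by (rule card_Un_le)
    also have "\<dots> \<le> card F' + card X" by (intro add_mono card_image_le finF' finX)
    finally have "card F \<le> card F' + card X" .
    moreover have "card X + card A + card (\<Union>E') = card (\<Union>E)"
    proof -
      have "\<Union>E = X \<union> (A \<union> \<Union>E')" using A(1) sub by (auto simp: X_def)
      moreover have "card (X \<union> (A \<union> \<Union>E')) = card X + card (A \<union> \<Union>E')"
        using finX finA finU by (intro card_Un_disjoint) (auto simp: X_def)
      moreover have "card (A \<union> \<Union>E') = card A + card (\<Union>E')"
        using finA finU A(2) by (intro card_Un_disjoint)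
      ultimately show ?thesis by simp
    qed
    ultimately show ?thesis by simp
  qed
  ultimately show ?thesis by blast
qed

section \<open>The induction on the number of non-isolated vertices\<close>

text \<open>
  Induction on the number of non-isolated vertices. If \<open>{v}\<close> is an edge, then \<open>x\<^sub>v\<close> is a generator and the
  other edges avoid \<open>v\<close>, so \<open>v\<close> can be split off. Otherwise neighbors of a vertex \<open>v\<close> are deleted one after
  the other. The set \<open>A\<close> of deleted neighbors stands for the ideal \<open>I + (x\<^sub>a : a \<in> A)\<close>. As long as \<open>v\<close> is
  in an edge that avoids \<open>A\<close>, that edge has a further vertex \<open>w\<close>, and the exact sequence for \<open>x\<^sub>w\<close> leaves the
  sum, with one more deleted neighbor, and the colon ideal, where \<open>w\<close> is contracted. When \<open>v\<close> has
  become isolated, only the edges that avoid \<open>A\<close> are left. Both ends have fewer vertices, and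
  dominant_lift transfers the bound to them: with \<open>c = w\<close> for the contraction, with \<open>c = v\<close> at the end.
  Deleting a single vertex would not do, since a family that dominates the remaining edges need not
  dominate the deleted vertex.
\<close>

lemma quotient_resolvable_dominant:
  assumes "finite (\<Union>E)" "\<Union>E \<subseteq> V" "antichain E"
    and "\<And>F. dominant E F \<Longrightarrow> card (\<Union>E) \<le> n + card F"
  shows "quotient_resolvable TYPE('k::field) V (Suc n) (up_closure E)"
  using assms
proof (induction "card (\<Union>E)" arbitrary: E n rule: less_induct)
  case less
  note fin = less.prems(1) and EV = less.prems(2) and anti = less.prems(3) and bound = less.prems(4)
  have finE: "finite E" using fin by (rule finite_UnionD)

  \<comment> \<open>The family \<open>E'\<close> needs only \<open>n - card A + 1\<close> free modules, which leaves room for adjoining the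
    variables in \<open>A\<close> as nonzerodivisors.\<close>
  have smaller: "quotient_resolvable TYPE('k) V (Suc n) {s. A \<inter> s \<noteq> {} \<or> s \<in> up_closure E'}"
    if E': "antichain E'" "\<Union>E' \<subset> \<Union>E" and A: "A \<subseteq> \<Union>E" "A \<inter> \<Union>E' = {}"
      and transfer: "\<And>F'. dominant E' F' \<Longrightarrow>
        \<exists>F. dominant E F \<and> card F + card A + card (\<Union>E') \<le> card F' + card (\<Union>E)"
    for E' A
  proof -
    have fin': "finite (\<Union>E')" and finA: "finite A"
      using finite_subset[of "\<Union>E'" "\<Union>E"] finite_subset[OF A(1)] fin E'(2) by blast+
    have *: "card (\<Union>E') + card A \<le> n + card F'" if "dominant E' F'" for F'
    proof -
      obtain F where "dominant E F" "card F + card A + card (\<Union>E') \<le> card F' + card (\<Union>E)"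
        using transfer[OF \<open>dominant E' F'\<close>] by blast
      then show ?thesis using bound[of F] by linarith
    qed
    \<comment> \<open>Guards the truncated subtraction \<open>n - card A\<close>.\<close>
    obtain F0 where "dominant E' F0" "card F0 \<le> card (\<Union>E')" using dominant_exists[OF fin'] .
    then have An: "card A \<le> n" using *[of F0] by linarith
    have "quotient_resolvable TYPE('k) V (Suc (n - card A)) (up_closure E')"
    proof (rule less.hyps)
      show "card (\<Union>E') < card (\<Union>E)" using psubset_card_mono[OF fin E'(2)] .
      show "card (\<Union>E') \<le> n - card A + card F" if "dominant E' F" for F
        using *[OF that] An by linarith
    qed (use fin' E' EV in auto)
    then have "quotient_resolvable TYPE('k) V (Suc (n - card A) + card A)
        {s. A \<inter> s \<noteq> {} \<or> s \<in> up_closure E'}"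
    proof (rule quotient_resolvable_variables[OF finA _ up_closed_up_closure, rotated 2])
      show "s \<in> up_closure E'" if "s \<union> A \<in> up_closure E'" for s
        using that A(2) unfolding up_closure_def by blast
    qed (use A(1) EV in auto)
    then show ?thesis using An by simp
  qed

  consider "\<Union>E = {}" | v where "{v} \<in> E" | v where "v \<in> \<Union>E" "{v} \<notin> E" by blast
  then show ?case
  proof cases
    case 1
    then have "E \<subseteq> {{}}" by auto
    then consider "E = {}" | "E = {{}}" using subset_singletonD by metis
    then show ?thesis
    proof cases
      case 1
      then show ?thesis using quotient_resolvable_empty[of V n] by (simp add: up_closure_def)
    next
      case 2
      then show ?thesis using quotient_resolvable_UNIV by (simp add: up_closure_def)
    qed
  next
    case 2
    let ?E' = "{e \<in> E. v \<notin> e}"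
    have E: "E = insert {v} ?E'"
    proof -
      have "e = {v}" if "e \<in> E" "v \<in> e" for e
        using anti 2 that unfolding antichain_def by blast
      then show ?thesis using 2 by blast
    qed
    have UE: "\<Union>E = insert v (\<Union>?E')" by (subst E) auto
    have "quotient_resolvable TYPE('k) V (Suc n) {s. {v} \<inter> s \<noteq> {} \<or> s \<in> up_closure ?E'}"
    proof (rule smaller)
      show "antichain ?E'" using anti by (auto simp: antichain_def)
      show "\<Union>?E' \<subset> \<Union>E" using 2 by blast
      show "\<exists>F. dominant E F \<and> card F + card {v} + card (\<Union>?E') \<le> card F' + card (\<Union>E)"
        if "dominant ?E' F'" for F'
      proof (intro exI conjI)
        show "dominant E F'"
          unfolding dominant_def
        proof (intro conjI ballI)
          show "F' \<subseteq> E" using that by (auto simp: dominant_def)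
          fix u assume "u \<in> \<Union>E"
          then consider "u = v" | "u \<in> \<Union>?E'" using UE by blast
          then show "{u} \<in> E \<or> (\<exists>e\<in>E. u \<in> e \<and> e \<inter> \<Union>F' \<noteq> {})"
            using that 2 unfolding dominant_def by cases blast+
        qed
        have "finite (\<Union>?E')" using fin by (rule rev_finite_subset) blast
        then have "card (\<Union>E) = Suc (card (\<Union>?E'))" unfolding UE by (intro card_insert_disjoint) auto
        then show "card F' + card {v} + card (\<Union>?E') \<le> card F' + card (\<Union>E)" by simp
      qed
    qed (use 2 in auto)
    moreover have "{s. {v} \<inter> s \<noteq> {} \<or> s \<in> up_closure ?E'} = up_closure E"
      by (subst (2) E) (auto simp: up_closure_def)
    ultimately show ?thesis by simp
  next
    case 3
    define N where "N = {w. w \<noteq> v \<and> (\<exists>e\<in>E. v \<in> e \<and> w \<in> e)}"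
    have NE: "N \<subseteq> \<Union>E" by (auto simp: N_def)
    then have finN: "finite N" using fin by (rule finite_subset)
    have "quotient_resolvable TYPE('k) V (Suc n) {s. A \<inter> s \<noteq> {} \<or> s \<in> up_closure E}"
      if "A \<subseteq> N" for A
      using that
    proof (induction "card (N - A)" arbitrary: A rule: less_induct)
      case inner: less
      let ?D = "{e \<in> E. e \<inter> A = {}}"
      have AN: "\<exists>e\<in>E. a \<in> e \<and> v \<in> e" if "a \<in> A" for a
        using inner.prems that by (auto simp: N_def)
      have vA: "v \<notin> A" and AE: "A \<subseteq> \<Union>E" using inner.prems NE by (auto simp: N_def)
      show ?case
      proof (cases "v \<in> \<Union>?D")
        case False
        have "quotient_resolvable TYPE('k) V (Suc n) {s. A \<inter> s \<noteq> {} \<or> s \<in> up_closure ?D}"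
        proof (rule smaller)
          show "antichain ?D" using anti by (auto simp: antichain_def)
          show "\<Union>?D \<subset> \<Union>E" using False 3 by blast
          obtain e0 where e0: "e0 \<in> E" "v \<in> e0" using 3 by blast
          show "\<exists>F. dominant E F \<and> card F + card A + card (\<Union>?D) \<le> card F' + card (\<Union>E)"
            if F': "dominant ?D F'" for F'
            by (rule dominant_lift[OF fin _ AE _ AN 3(1) False vA e0 e0(2) _ F']) blast+
        qed (use AE in auto)
        moreover have "{s. A \<inter> s \<noteq> {} \<or> s \<in> up_closure ?D} = {s. A \<inter> s \<noteq> {} \<or> s \<in> up_closure E}"
          unfolding up_closure_def by blast
        ultimately show ?thesis by simp
      next
        case True
        then obtain e0 where e0: "e0 \<in> E" "v \<in> e0" "e0 \<inter> A = {}" by blast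
        then have "e0 - {v} \<noteq> {}" using 3(2) by (metis Diff_eq_empty_iff empty_iff subset_singletonD)
        then obtain w where w: "w \<in> e0" "w \<noteq> v" by blast
        have wN: "w \<in> N" and wA: "w \<notin> A" and wE: "w \<in> \<Union>E" using e0 w by (auto simp: N_def)
        let ?U = "{s. A \<inter> s \<noteq> {} \<or> s \<in> up_closure E}"
        let ?G = "(\<lambda>e. e - {w}) ` ?D"
        let ?M = "minimals ?G"
        have ME: "\<exists>e\<in>E. f = e - {w} \<and> e \<inter> A = {}" if "f \<in> ?M" for f
          using that by (auto simp: minimals_def)
        show ?thesis
        proof (rule quotient_resolvable_colon_sum)
          show "up_closed ?U" by (fastforce simp: up_closed_def up_closure_def)
          show "w \<in> V" using wE EV by blast
          have "quotient_resolvable TYPE('k) V (Suc n) {s. A \<inter> s \<noteq> {} \<or> s \<in> up_closure ?M}"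
          proof (rule smaller)
            show "antichain ?M" by (rule antichain_minimals)
            have "\<Union>?M \<subseteq> \<Union>E" "w \<notin> \<Union>?M" using ME by blast+
            then show "\<Union>?M \<subset> \<Union>E" using wE by blast
            show AM: "A \<inter> \<Union>?M = {}" using ME by blast
            show "\<exists>F. dominant E F \<and> card F + card A + card (\<Union>?M) \<le> card F' + card (\<Union>E)"
              if F': "dominant ?M F'" for F'
            proof (rule dominant_lift[OF fin _ AE AM AN wE \<open>w \<notin> \<Union>?M\<close> wA e0(1) w(1) e0(2) _ F'])
              show "\<exists>e\<in>E. f \<subseteq> e" if "f \<in> ?M" for f using ME[OF that] by blast
              show "{u} \<in> E \<or> {u, w} \<in> E" if u: "{u} \<in> ?M" for u
              proof -
                obtain e where e: "e \<in> E" "{u} = e - {w}" using ME[OF u] by blast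
                then have "e = {u} \<or> e = {u, w}" by blast
                then show ?thesis using e(1) by blast
              qed
            qed
          qed (use AE in auto)
          moreover have "up_closure ?M = up_closure ?G" using finE by (intro up_closure_minimals) simp
          moreover have "{s. insert w s \<in> ?U} = {s. A \<inter> s \<noteq> {} \<or> s \<in> up_closure ?G}"
          proof (intro Collect_cong)
            fix s
            have "insert w s \<in> up_closure E \<longleftrightarrow> s \<in> up_closure ?G" if "A \<inter> s = {}"
            proof -
              have *: "e \<inter> A = {}" if "e \<subseteq> insert w s" for e
                using that \<open>A \<inter> s = {}\<close> wA by blast
              have "insert w s \<in> up_closure E \<longleftrightarrow> (\<exists>e\<in>?D. e \<subseteq> insert w s)"
              proof
                assume "insert w s \<in> up_closure E"
                then obtain e where e: "e \<in> E" "e \<subseteq> insert w s" unfolding up_closure_def by blast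
                then have "e \<in> ?D" using *[OF e(2)] by simp
                then show "\<exists>e\<in>?D. e \<subseteq> insert w s" using e(2) by (rule rev_bexI)
              next
                assume "\<exists>e\<in>?D. e \<subseteq> insert w s"
                then show "insert w s \<in> up_closure E" unfolding up_closure_def by blast
              qed
              also have "\<dots> \<longleftrightarrow> (\<exists>e\<in>?D. e - {w} \<subseteq> s)" by (simp add: Diff_subset_conv)
              finally show ?thesis by (simp only: up_closure_def mem_Collect_eq bex_simps)
            qed
            moreover have "A \<inter> insert w s = A \<inter> s" using wA by blast
            ultimately show "insert w s \<in> ?U \<longleftrightarrow> A \<inter> s \<noteq> {} \<or> s \<in> up_closure ?G" by auto
          qed
          ultimately show "quotient_resolvable TYPE('k) V (Suc n) {s. insert w s \<in> ?U}" by simp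
          have "quotient_resolvable TYPE('k) V (Suc n) {s. insert w A \<inter> s \<noteq> {} \<or> s \<in> up_closure E}"
          proof (rule inner.hyps)
            show "card (N - insert w A) < card (N - A)"
              using wN wA finN by (intro psubset_card_mono) auto
          qed (use wN inner.prems in auto)
          moreover have "{s. insert w A \<inter> s \<noteq> {} \<or> s \<in> up_closure E} = {s. w \<in> s \<or> s \<in> ?U}" by blast
          ultimately show "quotient_resolvable TYPE('k) V (Suc n) {s. w \<in> s \<or> s \<in> ?U}" by simp
        qed
      qed
    qed
    from this[of "{}"] show ?thesis by simp
  qed
qed

section \<open>From syzygies to projective resolutions\<close>

definition ring_of :: "'r::comm_ring_1 set \<Rightarrow> 'r ring"
where
  "ring_of K = \<lparr>carrier = K, mult = (*), one = 1, zero = 0, add = (+)\<rparr>"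

text \<open>
  The projective dimension is defined by modules with carriers in \<open>nat \<times> 'm \<Rightarrow> 'r\<close>. Vectors embed
  there by fixing the second index, at the arbitrary value \<open>undefined\<close>.
\<close>

definition encode :: "(nat \<Rightarrow> 'r::comm_ring_1) \<Rightarrow> nat \<times> 'm \<Rightarrow> 'r"
where
  "encode c = (\<lambda>(i, m). if m = undefined then c i else 0)"

definition decode :: "(nat \<times> 'm \<Rightarrow> 'r::comm_ring_1) \<Rightarrow> nat \<Rightarrow> 'r"
where
  "decode f = (\<lambda>i. f (i, undefined))"

definition free_module :: "'r::comm_ring_1 set \<Rightarrow> nat \<Rightarrow> ('r, nat \<times> 'm \<Rightarrow> 'r) module"
where
  "free_module K b = \<lparr>carrier = encode ` vecs K b, mult = (\<lambda>_ _. 0), one = 0, zero = 0,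
     add = (+), smult = (\<lambda>a f x. a * f x)\<rparr>"

lemma ring_of_simps [simp]:
  "carrier (ring_of K) = K" "a \<otimes>\<^bsub>ring_of K\<^esub> b = a * b" "\<one>\<^bsub>ring_of K\<^esub> = 1"
  "\<zero>\<^bsub>ring_of K\<^esub> = 0" "a \<oplus>\<^bsub>ring_of K\<^esub> b = a + b"
  by (simp_all add: ring_of_def)

lemma free_module_simps [simp]:
  "carrier (free_module K b) = encode ` vecs K b" "\<zero>\<^bsub>free_module K b\<^esub> = 0"
  "f \<oplus>\<^bsub>free_module K b\<^esub> g = f + g" "a \<odot>\<^bsub>free_module K b\<^esub> f = (\<lambda>x. a * f x)"
  by (simp_all add: free_module_def)

lemma decode_encode [simp]: "decode (encode c) = c"
  by (simp add: decode_def encode_def)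

lemma encode_eq_iff [simp]: "encode c = encode d \<longleftrightarrow> c = d"
  by (metis decode_encode)

lemma encode_linear:
  "encode c + encode d = encode (c + d)" "(\<lambda>x. a * encode c x) = encode (scale a c)"
  "encode 0 = 0"
  by (auto simp: encode_def fun_eq_iff)

lemma (in coefficients) cring_ring_of: "cring (ring_of K)"
proof (rule cringI)
  show "abelian_group (ring_of K)"
  proof (rule abelian_groupI)
    fix x assume "x \<in> carrier (ring_of K)"
    then show "\<exists>y\<in>carrier (ring_of K). y \<oplus>\<^bsub>ring_of K\<^esub> x = \<zero>\<^bsub>ring_of K\<^esub>"
      by (auto intro!: bexI[of _ "- x"])
  qed (simp_all add: algebra_simps)
  show "Group.comm_monoid (ring_of K)"
    by (rule comm_monoidI) (simp_all add: algebra_simps)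
qed (simp add: algebra_simps)

lemma (in coefficients) module_free_module: "Module.module (ring_of K) (free_module K b)"
proof (rule moduleI)
  note mem = submodD[OF submod_vecs]
  show "cring (ring_of K)" by (rule cring_ring_of)
  show "abelian_group (free_module K b)"
  proof (rule abelian_groupI)
    fix x assume "x \<in> carrier (free_module K b)"
    then obtain c where "c \<in> vecs K b" "x = encode c" by auto
    then show "\<exists>y\<in>carrier (free_module K b). y \<oplus>\<^bsub>free_module K b\<^esub> x = \<zero>\<^bsub>free_module K b\<^esub>"
      using mem(4)[of c b] by (auto simp: encode_linear intro!: bexI[of _ "- c"])
  next
    show "\<zero>\<^bsub>free_module K b\<^esub> \<in> carrier (free_module K b)"
      using mem(1)[of b] by (auto simp flip: encode_linear(3))
  qed (auto simp: encode_linear add.assoc add.commute intro!: imageI mem)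
qed (auto simp: encode_linear algebra_simps fun_eq_iff intro!: imageI submodD[OF submod_vecs])

text \<open>
  The linear combination of \<open>t 0, \<dots>, t (k - 1)\<close> in the module \<open>N\<close> with coefficients \<open>c\<close>: the linear map
  that sends the basis of a free module to the \<open>t i\<close>.
\<close>

primrec lift :: "('r, 'x) ring_scheme \<Rightarrow> ('r, 'n) module \<Rightarrow> (nat \<Rightarrow> 'n) \<Rightarrow> nat \<Rightarrow> (nat \<Rightarrow> 'r) \<Rightarrow> 'n"
where
  "lift R N t 0 c = \<zero>\<^bsub>N\<^esub>"
| "lift R N t (Suc k) c = lift R N t k c \<oplus>\<^bsub>N\<^esub> c k \<odot>\<^bsub>N\<^esub> t k"

lemma (in coefficients) lift_linear:
  assumes N: "Module.module (ring_of K) N" and t: "\<And>i. i < k \<Longrightarrow> t i \<in> carrier N"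
    and c: "\<And>i. c i \<in> K"
  shows "lift (ring_of K) N t k c \<in> carrier N"
    and "(\<And>i. d i \<in> K) \<Longrightarrow> lift (ring_of K) N t k (c + d)
      = lift (ring_of K) N t k c \<oplus>\<^bsub>N\<^esub> lift (ring_of K) N t k d"
    and "a \<in> K \<Longrightarrow> lift (ring_of K) N t k (scale a c) = a \<odot>\<^bsub>N\<^esub> lift (ring_of K) N t k c"
proof -
  interpret N: Module.module "ring_of K" N by (rule N)
  have mem: "lift (ring_of K) N t k c \<in> carrier N"
    if "\<And>i. i < k \<Longrightarrow> t i \<in> carrier N" "\<And>i. c i \<in> K" for k c
    using that(1)
  proof (induction k)
    case (Suc k)
    then show ?case using N.smult_closed[of "c k" "t k"] that(2) by simp
  qed simp
  show "lift (ring_of K) N t k c \<in> carrier N" by (rule mem[OF t c])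
  show "lift (ring_of K) N t k (c + d)
      = lift (ring_of K) N t k c \<oplus>\<^bsub>N\<^esub> lift (ring_of K) N t k d" if d: "\<And>i. d i \<in> K"
    using t
  proof (induction k)
    case (Suc k)
    have tk: "t k \<in> carrier N" and lc: "lift (ring_of K) N t k c \<in> carrier N"
      and ld: "lift (ring_of K) N t k d \<in> carrier N"
      using Suc.prems mem[of k c] mem[of k d] c d by auto
    have "(c k + d k) \<odot>\<^bsub>N\<^esub> t k = c k \<odot>\<^bsub>N\<^esub> t k \<oplus>\<^bsub>N\<^esub> d k \<odot>\<^bsub>N\<^esub> t k"
      using N.smult_l_distr[of "c k" "d k" "t k"] tk c d by simp
    then show ?case
      using Suc tk lc ld N.smult_closed[of "c k" "t k"] N.smult_closed[of "d k" "t k"] c d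
      by (simp add: N.M.a_ac)
  qed simp
  show "lift (ring_of K) N t k (scale a c) = a \<odot>\<^bsub>N\<^esub> lift (ring_of K) N t k c" if a: "a \<in> K"
    using t
  proof (induction k)
    case 0
    then show ?case using N.smult_r_null[of a] a by simp
  next
    case (Suc k)
    have tk: "t k \<in> carrier N" and lc: "lift (ring_of K) N t k c \<in> carrier N"
      using Suc.prems mem[of k c] c by auto
    have "(a * c k) \<odot>\<^bsub>N\<^esub> t k = a \<odot>\<^bsub>N\<^esub> (c k \<odot>\<^bsub>N\<^esub> t k)"
      using N.smult_assoc1[of a "c k" "t k"] tk c a by simp
    then show ?case
      using Suc tk lc N.smult_closed[of "c k" "t k"] c a N.smult_r_distr[of a] by simp
  qed
qed

lemma module_hom_zero:
  assumes "Module.module R M" "Module.module R N" "f \<in> module_hom R M N"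
  shows "f \<zero>\<^bsub>M\<^esub> = \<zero>\<^bsub>N\<^esub>"
proof -
  interpret M: Module.module R M by fact
  interpret N: Module.module R N by fact
  have "f (\<zero>\<^bsub>R\<^esub> \<odot>\<^bsub>M\<^esub> \<zero>\<^bsub>M\<^esub>) = \<zero>\<^bsub>R\<^esub> \<odot>\<^bsub>N\<^esub> f \<zero>\<^bsub>M\<^esub>"
    using assms(3) M.R.zero_closed M.M.zero_closed unfolding module_hom_def by blast
  moreover have "f \<zero>\<^bsub>M\<^esub> \<in> carrier N" using assms(3) M.M.zero_closed by (auto simp: module_hom_def)
  ultimately show ?thesis by simp
qed

text \<open>
  Preimages under \<open>g\<close> of the images of the basis vectors determine the lifting.
\<close>

lemma (in coefficients) projective_free_module:
  "projective_module (ring_of K) (free_module K b :: ('r, nat \<times> 'm \<Rightarrow> 'r) module)"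
  unfolding projective_module_def
proof (intro conjI module_free_module allI impI)
  fix N L :: "('r, (nat \<times> 'm \<Rightarrow> 'r) \<Rightarrow> 'r) module"
    and g and h :: "(nat \<times> 'm \<Rightarrow> 'r) \<Rightarrow> (nat \<times> 'm \<Rightarrow> 'r) \<Rightarrow> 'r"
  assume asm: "Module.module (ring_of K) N \<and> Module.module (ring_of K) L \<and>
    g \<in> module_hom (ring_of K) N L \<and> g ` carrier N = carrier L \<and>
    h \<in> module_hom (ring_of K) (free_module K b) L"
  then have N: "Module.module (ring_of K) N" and L: "Module.module (ring_of K) L"
    and g: "g \<in> module_hom (ring_of K) N L" and gL: "g ` carrier N = carrier L"
    and h: "h \<in> module_hom (ring_of K) (free_module K b) L" by auto
  interpret L: Module.module "ring_of K" L by (rule L)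
  interpret N: Module.module "ring_of K" N by (rule N)
  define basis where "basis = (\<lambda>(k::nat) i. if i = k then 1 else (0::'r))"
  have basis: "basis k \<in> vecs K b" if "k < b" for k using that by (auto simp: basis_def vecs_def)
  have hL: "h (encode c) \<in> carrier L" if "c \<in> vecs K b" for c
    using h that by (auto simp: module_hom_def)
  have hadd: "h (encode (c + d)) = h (encode c) \<oplus>\<^bsub>L\<^esub> h (encode d)"
    if "c \<in> vecs K b" "d \<in> vecs K b" for c d
    using h that by (auto simp: module_hom_def encode_linear)
  have hsc: "h (encode (scale a c)) = a \<odot>\<^bsub>L\<^esub> h (encode c)" if "c \<in> vecs K b" "a \<in> K" for c a
    using h that by (auto simp: module_hom_def encode_linear)
  have "\<forall>i. \<exists>n. i < b \<longrightarrow> n \<in> carrier N \<and> g n = h (encode (basis i))"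
    using hL[OF basis] gL by (metis imageE)
  then obtain t where t: "\<And>i. i < b \<Longrightarrow> t i \<in> carrier N" "\<And>i. i < b \<Longrightarrow> g (t i) = h (encode (basis i))"
    by metis
  let ?l = "lift (ring_of K) N t"
  have g_lift: "g (?l k c) = h (encode (\<lambda>i. if i < k then c i else 0))"
    if "k \<le> b" and c: "c \<in> vecs K b" for k c
    using \<open>k \<le> b\<close>
  proof (induction k)
    case 0
    have "h (encode 0) = \<zero>\<^bsub>L\<^esub>"
      using module_hom_zero[OF module_free_module L h] by (simp add: encode_linear)
    moreover have "g \<zero>\<^bsub>N\<^esub> = \<zero>\<^bsub>L\<^esub>" by (rule module_hom_zero[OF N L g])
    moreover have "(\<lambda>i::nat. 0) = (0 :: nat \<Rightarrow> 'r)" by auto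
    ultimately show ?case by simp
  next
    case (Suc k)
    have cK: "\<And>i. c i \<in> K" using c by (auto simp: vecs_def)
    have lk: "?l k c \<in> carrier N" using lift_linear(1)[OF N _ cK, of k t] t Suc.prems by auto
    have tk: "t k \<in> carrier N" using t Suc.prems by auto
    have "g (?l (Suc k) c) = g (?l k c) \<oplus>\<^bsub>L\<^esub> g (c k \<odot>\<^bsub>N\<^esub> t k)"
      using g lk N.smult_closed[of "c k" "t k"] cK tk by (simp add: module_hom_def)
    also have "g (c k \<odot>\<^bsub>N\<^esub> t k) = c k \<odot>\<^bsub>L\<^esub> h (encode (basis k))"
      using g tk t(2)[of k] cK Suc.prems by (simp add: module_hom_def)
    also have "\<dots> = h (encode (scale (c k) (basis k)))"
      using hsc[OF basis] cK Suc.prems by simp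
    also have "g (?l k c) = h (encode (\<lambda>i. if i < k then c i else 0))"
      using Suc by simp
    also have "h (encode (\<lambda>i. if i < k then c i else 0)) \<oplus>\<^bsub>L\<^esub> h (encode (scale (c k) (basis k)))
        = h (encode ((\<lambda>i. if i < k then c i else 0) + scale (c k) (basis k)))"
    proof (rule hadd[symmetric])
      show "(\<lambda>i. if i < k then c i else 0) \<in> vecs K b" using c by (auto simp: vecs_def)
      show "scale (c k) (basis k) \<in> vecs K b"
        using submodD(3)[OF submod_vecs cK basis] Suc.prems by simp
    qed
    also have "(\<lambda>i. if i < k then c i else 0) + scale (c k) (basis k) = (\<lambda>i. if i < Suc k then c i else 0)"
      by (auto simp: fun_eq_iff basis_def less_Suc_eq)
    finally show ?case .
  qed
  have trunc: "(\<lambda>i. if i < b then c i else 0) = c" if "c \<in> vecs K b" for c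
    using that by (auto simp: vecs_def fun_eq_iff)
  let ?P = "free_module K b :: ('r, nat \<times> 'm \<Rightarrow> 'r) module"
  show "\<exists>h'\<in>module_hom (ring_of K) ?P N. \<forall>x\<in>carrier ?P. g (h' x) = h x"
  proof (intro bexI ballI)
    fix x assume "x \<in> carrier ?P"
    then obtain c where "c \<in> vecs K b" "x = encode c" by auto
    then show "g (?l b (decode x)) = h x" using g_lift[of b c] trunc by simp
  next
    have "\<And>c i. c \<in> vecs K b \<Longrightarrow> c i \<in> K" by (auto simp: vecs_def)
    then show "(\<lambda>x. ?l b (decode x)) \<in> module_hom (ring_of K) ?P N"
      using lift_linear[OF N t(1)] by (auto simp: module_hom_def encode_linear)
  qed
qed

text \<open>
  Unrolls the recursion: \<open>S i\<close> is the \<open>i\<close>-th syzygy module and \<open>G i\<close> the chosen system of \<open>B i\<close>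
  generators. Only the first one is taken modulo \<open>N\<close>.
\<close>

lemma (in coefficients) syzygy_sequence:
  assumes "resolvable K n M N" "submod K N"
  obtains S B G where "S 0 = M"
    and "\<And>i. generates K (B i) (G i) (S i) (if i = 0 then N else {0})"
    and "\<And>i. S (Suc i) = syz K (B i) (G i) (if i = 0 then N else {0})"
    and "\<And>i. n \<le> i \<Longrightarrow> B i = 0"
proof -
  have "\<exists>B G S. S 0 = M \<and> (\<forall>i. generates K (B i) (G i) (S i) (if i = 0 then N else {0}) \<and>
      S (Suc i) = syz K (B i) (G i) (if i = 0 then N else {0})) \<and> (\<forall>i\<ge>n. B i = 0)"
    using assms
  proof (induction n arbitrary: M N)
    case 0
    show ?case
    proof (intro exI conjI allI impI)
      fix i :: nat
      show "generates K 0 (\<lambda>_. 0) (if i = 0 then M else {0}) (if i = 0 then N else {0})"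
        using 0 by (auto simp: generates_def vecs_0)
      show "(if Suc i = 0 then M else {0}) = syz K 0 (\<lambda>_. 0) (if i = 0 then N else {0})"
        using submodD(1)[OF 0(2)] by (auto simp: syz_def vecs_0)
    qed simp_all
  next
    case (Suc n)
    then obtain b g where g: "generates K b g M N" "resolvable K n (syz K b g N) {0}"
      unfolding resolvable.simps by blast
    obtain B G S where S: "S 0 = syz K b g N"
      "\<forall>i. generates K (B i) (G i) (S i) {0} \<and> S (Suc i) = syz K (B i) (G i) {0}"
      "\<forall>i\<ge>n. B i = 0"
      using Suc.IH[OF g(2) submod_zero] unfolding if_cancel by blast
    show ?case
    proof (intro exI conjI allI impI)
      show "case_nat M S 0 = M" by simp
      fix i
      show "generates K (case_nat b B i) (case_nat g G i) (case_nat M S i) (if i = 0 then N else {0})"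
        using g S by (cases i) auto
      show "case_nat M S (Suc i) = syz K (case_nat b B i) (case_nat g G i) (if i = 0 then N else {0})"
        using S by (cases i) auto
      show "Suc n \<le> i \<Longrightarrow> case_nat b B i = 0" using S by (cases i) auto
    qed
  qed
  then show ?thesis using that by blast
qed

text \<open>
  Here \<open>q\<close> induces an isomorphism from \<open>M / N\<close> onto the abstract module \<open>Q\<close>. The \<open>i\<close>-th term of the
  projective resolution is free on the \<open>B i\<close> generators of the \<open>i\<close>-th syzygy module, and the differential
  evaluates linear combinations of generators.
\<close>

theorem (in coefficients) projective_dimension_le:
  assumes res: "resolvable K (Suc n) M N" and M: "submod K M" and N: "submod K N" "N \<subseteq> M"
    and add: "\<And>x y. x \<in> M \<Longrightarrow> y \<in> M \<Longrightarrow> q (x + y) = q x \<oplus>\<^bsub>Q\<^esub> q y"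
    and smult: "\<And>a x. a \<in> K \<Longrightarrow> x \<in> M \<Longrightarrow> q (scale a x) = a \<odot>\<^bsub>Q\<^esub> q x"
    and onto: "q ` M = carrier Q"
    and eq: "\<And>x y. x \<in> M \<Longrightarrow> y \<in> M \<Longrightarrow> q x = q y \<longleftrightarrow> x - y \<in> N"
    and q0: "q 0 = \<zero>\<^bsub>Q\<^esub>"
  shows "projective_dimension (ring_of K) (Q :: ('r, 'm) module) \<le> ereal (real n)"
proof -
  obtain S B G where S0: "S 0 = M"
    and gen: "\<And>i. generates K (B i) (G i) (S i) (if i = 0 then N else {0})"
    and SS: "\<And>i. S (Suc i) = syz K (B i) (G i) (if i = 0 then N else {0})"
    and B0: "\<And>i. Suc n \<le> i \<Longrightarrow> B i = 0"
    using syzygy_sequence[OF res N(1)] by blast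
  define P :: "nat \<Rightarrow> ('r, nat \<times> 'm \<Rightarrow> 'r) module" where "P = (\<lambda>i. free_module K (B i))"
  define l where "l = (\<lambda>i c. lincomb (B i) c (G i))"
  define d :: "nat \<Rightarrow> (nat \<times> 'm \<Rightarrow> 'r) \<Rightarrow> nat \<times> 'm \<Rightarrow> 'r"
    where "d = (\<lambda>i f. encode (l (Suc i) (decode f)))"
  define p :: "(nat \<times> 'm \<Rightarrow> 'r) \<Rightarrow> 'm" where "p = (\<lambda>f. q (l 0 (decode f)))"
  have S: "submod K (S i)" for i
    using M S0 SS submod_syz[OF N(1)] submod_syz[OF submod_zero] by (cases i) auto
  have lS: "l i c \<in> S i" if "c \<in> vecs K (B i)" for i c
    unfolding l_def
    by (rule lincomb_mem[OF S]) (use gen[of i] that in \<open>auto simp: generates_def vecs_def\<close>)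
  have SB: "S (Suc i) \<subseteq> vecs K (B i)" for i using SS[of i] by (auto simp: syz_def)
  have image: "l (Suc i) ` vecs K (B (Suc i)) = S (Suc i)" for i
  proof
    show "S (Suc i) \<subseteq> l (Suc i) ` vecs K (B (Suc i))"
      using gen[of "Suc i"] by (fastforce simp: generates_def l_def)
  qed (use lS in auto)
  have carrier: "carrier (P i) = encode ` vecs K (B i)" for i by (simp add: P_def)
  have d_image: "d i ` carrier (P (Suc i)) = encode ` S (Suc i)" for i
    unfolding carrier image[symmetric] image_image by (simp add: d_def)
  have linear: "l i (c + c') = l i c + l i c'" "l i (scale a c) = scale a (l i c)" for i c c' a
    by (simp_all add: l_def lincomb_add lincomb_scale)
  have l0: "l 0 c \<in> M" if "c \<in> vecs K (B 0)" for c using lS[OF that] S0 by simp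
  have "projective_resolution (ring_of K) Q P d p"
    unfolding projective_resolution_def
  proof (intro conjI allI)
    fix i
    show "projective_module (ring_of K) (P i)"
      unfolding P_def by (rule projective_free_module)
    have "l (Suc i) c \<in> vecs K (B i)" if "c \<in> vecs K (B (Suc i))" for c
      using lS[OF that] SB[of i] by blast
    then show "d i \<in> module_hom (ring_of K) (P (Suc i)) (P i)"
      by (auto simp: module_hom_def P_def d_def encode_linear linear)
    show "d (Suc i) ` carrier (P (Suc (Suc i))) = a_kernel (P (Suc i)) (P i) (d i)"
    proof -
      have "a_kernel (P (Suc i)) (P i) (d i) = encode ` syz K (B (Suc i)) (G (Suc i)) {0}"
        unfolding a_kernel_def' syz_def l_def[symmetric]
        by (auto simp: P_def d_def l_def simp flip: encode_linear(3))
      then show ?thesis unfolding d_image SS[of "Suc i"] by simp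
    qed
  next
    show "p \<in> module_hom (ring_of K) (P 0) Q"
      using l0 onto add smult by (auto simp: module_hom_def P_def p_def encode_linear linear)
    show "p ` carrier (P 0) = carrier Q"
    proof
      show "carrier Q \<subseteq> p ` carrier (P 0)"
      proof
        fix y assume "y \<in> carrier Q"
        then obtain x where x: "x \<in> M" "y = q x" using onto by blast
        then obtain c where c: "c \<in> vecs K (B 0)" "x - l 0 c \<in> N"
          using gen[of 0] S0 by (auto simp: generates_def l_def)
        then have "y = p (encode c)" using eq[OF x(1) l0[OF c(1)]] x(2) by (simp add: p_def)
        then show "y \<in> p ` carrier (P 0)" using c(1) by (auto simp: P_def)
      qed
    qed (use l0 onto in \<open>auto simp: P_def p_def\<close>)
    have "q x = \<zero>\<^bsub>Q\<^esub> \<longleftrightarrow> x \<in> N" if "x \<in> M" for x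
      using eq[OF that submodD(1)[OF M]] q0 by simp
    then have "a_kernel (P 0) Q p = encode ` syz K (B 0) (G 0) N"
      unfolding a_kernel_def' syz_def using l0 by (auto simp: P_def p_def l_def)
    then show "d 0 ` carrier (P 1) = a_kernel (P 0) Q p"
      using d_image[of 0] SS[of 0] by simp
  qed
  moreover have "carrier (P i) = {\<zero>\<^bsub>P i\<^esub>}" if "n < i" for i
    using B0[of i] that by (simp add: P_def vecs_0 encode_linear)
  ultimately have "ereal (real n) \<in> {ereal (real n) | n. \<exists>(P :: nat \<Rightarrow> ('r, nat \<times> 'm \<Rightarrow> 'r) module) d p.
      projective_resolution (ring_of K) Q P d p \<and> (\<forall>i>n. carrier (P i) = {\<zero>\<^bsub>P i\<^esub>})}"
    by blast
  then have "Inf {ereal (real n) | n. \<exists>(P :: nat \<Rightarrow> ('r, nat \<times> 'm \<Rightarrow> 'r) module) d p.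
      projective_resolution (ring_of K) Q P d p \<and> (\<forall>i>n. carrier (P i) = {\<zero>\<^bsub>P i\<^esub>})} \<le> ereal (real n)"
    by (rule Inf_lower)
  then show ?thesis unfolding projective_dimension_def by simp
qed

section \<open>Edge ideals\<close>

lemma polynomial_ring_eq: "polynomial_ring V = ring_of (supported V)"
  by (simp add: polynomial_ring_def ring_of_def supported_def)

lemma squarefree_monomial_eq:
  assumes "finite e"
  shows "squarefree_monomial e = Poly_Mapping.single (\<Sum>v\<in>e. Poly_Mapping.single v 1) (1::'k::field)"
  using assms
proof (induction e)
  case (insert v e)
  then show ?case by (simp add: squarefree_monomial_def variable_def mult_single)
qed (simp add: squarefree_monomial_def)

lemma keys_sum_single:
  assumes "finite e"
  shows "Poly_Mapping.keys (\<Sum>v\<in>e. Poly_Mapping.single v (1::nat)) = e"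
  using assms by (induction e) (auto simp: keys_add_nat)

definition monomial_ideal :: "'v set \<Rightarrow> 'v set set \<Rightarrow> (('v \<Rightarrow>\<^sub>0 nat) \<Rightarrow>\<^sub>0 'k::field) set"
where
  "monomial_ideal V U = {f \<in> supported V. \<forall>m\<in>Poly_Mapping.keys f. Poly_Mapping.keys m \<in> U}"

lemma ring_of_minus:
  assumes "x \<in> supported V" "y \<in> supported V"
  shows "\<ominus>\<^bsub>ring_of (supported V)\<^esub> y = - y" "x \<ominus>\<^bsub>ring_of (supported V)\<^esub> y = x - y"
proof -
  interpret cring "ring_of (supported V)" by (rule supported.cring_ring_of)
  show "\<ominus>\<^bsub>ring_of (supported V)\<^esub> y = - y"
    by (rule minus_equality) (use assms in simp_all)
  then show "x \<ominus>\<^bsub>ring_of (supported V)\<^esub> y = x - y" by (simp add: a_minus_def)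
qed

lemma ideal_monomial_ideal:
  assumes U: "up_closed U"
  shows "ideal (monomial_ideal V U :: (('v \<Rightarrow>\<^sub>0 nat) \<Rightarrow>\<^sub>0 'k::field) set) (ring_of (supported V))"
proof -
  let ?J = "monomial_ideal V U :: (('v \<Rightarrow>\<^sub>0 nat) \<Rightarrow>\<^sub>0 'k) set"
  interpret cring "ring_of (supported V :: (('v \<Rightarrow>\<^sub>0 nat) \<Rightarrow>\<^sub>0 'k) set)" by (rule supported.cring_ring_of)
  have sub: "?J \<subseteq> supported V" by (auto simp: monomial_ideal_def)
  have add: "a + b \<in> ?J" if "a \<in> ?J" "b \<in> ?J" for a b
    using that Poly_Mapping.keys_add[of a b] by (auto simp: monomial_ideal_def)
  have mult: "x * a \<in> ?J" if a: "a \<in> ?J" and x: "x \<in> supported V" for a x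
  proof -
    have "Poly_Mapping.keys m \<in> U" if m: "m \<in> Poly_Mapping.keys (x * a)" for m
    proof -
      obtain p q where "m = p + q" "q \<in> Poly_Mapping.keys a"
        using m Poly_Mapping.keys_mult[of x a] by blast
      then show ?thesis using a U by (auto simp: monomial_ideal_def up_closed_def keys_add_nat)
    qed
    then show ?thesis using a x by (auto simp: monomial_ideal_def)
  qed
  show ?thesis
  proof (rule idealI)
    show "ring (ring_of (supported V :: (('v \<Rightarrow>\<^sub>0 nat) \<Rightarrow>\<^sub>0 'k) set))" by (rule ring_axioms)
    show "subgroup ?J (add_monoid (ring_of (supported V)))"
    proof (rule add.subgroupI)
      have "0 \<in> ?J" by (simp add: monomial_ideal_def)
      then show "?J \<noteq> {}" by blast
      show "\<ominus>\<^bsub>ring_of (supported V)\<^esub> a \<in> ?J" if "a \<in> ?J" for a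
        using that mult[of a "- 1"] ring_of_minus(1)[of a V a] sub by auto
    qed (use sub add in auto)
  next
    fix a x :: "('v \<Rightarrow>\<^sub>0 nat) \<Rightarrow>\<^sub>0 'k"
    assume a: "a \<in> ?J" and x: "x \<in> carrier (ring_of (supported V))"
    show "x \<otimes>\<^bsub>ring_of (supported V)\<^esub> a \<in> ?J" using mult[OF a] x by simp
    then show "a \<otimes>\<^bsub>ring_of (supported V)\<^esub> x \<in> ?J" by (simp add: mult.commute)
  qed
qed

text \<open>
  A monomial whose support contains the edge \<open>e\<close> is a multiple of \<open>x\<^sup>e\<close>, and a polynomial is the sum of its
  terms.
\<close>

lemma edge_ideal_eq:
  assumes "finite V" "E \<subseteq> Pow V"
  shows "edge_ideal V E = (monomial_ideal V (up_closure E) :: (('v \<Rightarrow>\<^sub>0 nat) \<Rightarrow>\<^sub>0 'k::field) set)"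
proof
  let ?R = "ring_of (supported V :: (('v \<Rightarrow>\<^sub>0 nat) \<Rightarrow>\<^sub>0 'k) set)"
  let ?J = "monomial_ideal V (up_closure E) :: (('v \<Rightarrow>\<^sub>0 nat) \<Rightarrow>\<^sub>0 'k) set"
  let ?G = "squarefree_monomial ` E :: (('v \<Rightarrow>\<^sub>0 nat) \<Rightarrow>\<^sub>0 'k) set"
  interpret cring ?R by (rule supported.cring_ring_of)
  have finE: "finite e" if "e \<in> E" for e using that assms finite_subset by blast
  have G: "?G \<subseteq> ?J"
  proof
    fix f assume "f \<in> ?G"
    then obtain e where e: "e \<in> E" "f = squarefree_monomial e" by blast
    then show "f \<in> ?J"
      using assms by (auto simp: squarefree_monomial_eq finE monomial_ideal_def supported_def
          keys_sum_single up_closure_def simp del: One_nat_def)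
  qed
  show "edge_ideal V E \<subseteq> ?J"
    unfolding edge_ideal_def polynomial_ring_eq
    by (rule genideal_minimal[OF ideal_monomial_ideal[OF up_closed_up_closure] G])
  have GR: "?G \<subseteq> carrier ?R" using G by (auto simp: monomial_ideal_def)
  interpret I: ideal "genideal ?R ?G" ?R by (rule genideal_ideal[OF GR])
  show "?J \<subseteq> edge_ideal V E"
    unfolding edge_ideal_def polynomial_ring_eq
  proof
    fix f assume f: "f \<in> ?J"
    have term_mem: "Poly_Mapping.single m (Poly_Mapping.lookup f m) \<in> genideal ?R ?G"
      if m: "m \<in> Poly_Mapping.keys f" for m
    proof -
      obtain e where e: "e \<in> E" "e \<subseteq> Poly_Mapping.keys m"
        using f m by (auto simp: monomial_ideal_def up_closure_def)
      define x where "x = (\<Sum>v\<in>e. Poly_Mapping.single v (1::nat))"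
      have "Poly_Mapping.lookup x v = (if v \<in> e then 1 else 0)" for v
        using finE[OF e(1)] by (simp add: x_def lookup_sum lookup_single when_def)
      then have "(m - x) + x = m"
        using e(2) by (intro poly_mapping_eqI) (auto simp: lookup_add lookup_minus in_keys_iff subset_iff)
      then have "Poly_Mapping.single m (Poly_Mapping.lookup f m)
          = Poly_Mapping.single (m - x) (Poly_Mapping.lookup f m) * squarefree_monomial e"
        by (simp add: squarefree_monomial_eq[OF finE[OF e(1)]] mult_single del: One_nat_def flip: x_def)
      moreover have "Poly_Mapping.keys (m - x) \<subseteq> V"
      proof -
        have "Poly_Mapping.keys (m - x) \<subseteq> Poly_Mapping.keys m"
          by (auto simp: in_keys_iff lookup_minus)
        then show ?thesis using f m by (auto simp: monomial_ideal_def supported_def)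
      qed
      then have "Poly_Mapping.single (m - x) (Poly_Mapping.lookup f m) \<in> carrier ?R"
        by (simp add: supported_def)
      moreover have "squarefree_monomial e \<in> genideal ?R ?G"
        using genideal_self[OF GR] e(1) by blast
      ultimately show ?thesis
        using I.I_l_closed[of "squarefree_monomial e" "Poly_Mapping.single (m - x) (Poly_Mapping.lookup f m)"]
        by simp
    qed
    have "(\<Sum>m\<in>A. Poly_Mapping.single m (Poly_Mapping.lookup f m)) \<in> genideal ?R ?G"
      if "A \<subseteq> Poly_Mapping.keys f" "finite A" for A
      using that(2,1)
    proof (induction A)
      case empty
      show ?case using I.zero_closed by simp
    next
      case (insert m A)
      then show ?case using I.a_closed[OF term_mem[of m]] by simp
    qed
    from this[of "Poly_Mapping.keys f"] show "f \<in> genideal ?R ?G" by (simp add: sum_monomials)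
  qed
qed

lemma projective_dimension_quotient_le:
  assumes U: "up_closed U" and res: "quotient_resolvable TYPE('k::field) V (Suc n) U"
  shows "projective_dimension (polynomial_ring V :: (('v \<Rightarrow>\<^sub>0 nat) \<Rightarrow>\<^sub>0 'k) ring)
    (quotient_module (polynomial_ring V) (monomial_ideal V U)) \<le> ereal (real n)"
  unfolding polynomial_ring_eq
proof (rule supported.projective_dimension_le)
  let ?K = "supported V :: (('v \<Rightarrow>\<^sub>0 nat) \<Rightarrow>\<^sub>0 'k) set"
  let ?R = "ring_of ?K"
  let ?I = "monomial_ideal V U :: (('v \<Rightarrow>\<^sub>0 nat) \<Rightarrow>\<^sub>0 'k) set"
  let ?q = "\<lambda>c. ?I +>\<^bsub>?R\<^esub> c (0::nat)"
  interpret ideal ?I ?R by (rule ideal_monomial_ideal[OF U])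
  have c0: "c 0 \<in> ?K" if "c \<in> vecs ?K 1" for c using that by (auto simp: vecs_def)
  show "resolvable ?K (Suc n) (vecs ?K 1) (monomial_vecs V U)"
    using res by (simp add: quotient_resolvable_def)
  show "monomial_vecs V U \<subseteq> vecs ?K 1" by (rule monomial_vecs_subset)
  show "submod ?K (monomial_vecs V U)" by (rule submod_monomial_vecs[OF U])
  show "submod ?K (vecs ?K 1)" by simp
  show "?q (x + y) = ?q x \<oplus>\<^bsub>quotient_module ?R ?I\<^esub> ?q y" if "x \<in> vecs ?K 1" "y \<in> vecs ?K 1" for x y
    using ring_hom_add[OF rcos_ring_hom, of "x 0" "y 0"] c0 that by (simp add: quotient_module_def)
  show "?q (scale a x) = a \<odot>\<^bsub>quotient_module ?R ?I\<^esub> ?q x" if "a \<in> ?K" "x \<in> vecs ?K 1" for a x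
    using ring_hom_mult[OF rcos_ring_hom, of a "x 0"] c0 that by (simp add: quotient_module_def)
  show "?q ` vecs ?K 1 = carrier (quotient_module ?R ?I)"
  proof -
    have "?K = (\<lambda>c. c 0) ` vecs ?K 1"
    proof
      show "?K \<subseteq> (\<lambda>c. c 0) ` vecs ?K 1"
      proof
        fix a assume "a \<in> ?K"
        then have "(\<lambda>i. if i = 0 then a else 0) \<in> vecs ?K 1" by (simp add: vecs_def)
        then show "a \<in> (\<lambda>c. c 0) ` vecs ?K 1" by (rule rev_image_eqI) simp
      qed
    qed (use c0 in blast)
    moreover have "carrier (quotient_module ?R ?I) = (\<lambda>a. ?I +>\<^bsub>?R\<^esub> a) ` ?K"
      by (auto simp: quotient_module_def FactRing_def A_RCOSETS_def' a_r_coset_def)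
    ultimately show ?thesis by (metis image_image)
  qed
  show "?q x = ?q y \<longleftrightarrow> x - y \<in> monomial_vecs V U" if "x \<in> vecs ?K 1" "y \<in> vecs ?K 1" for x y
  proof -
    have "?q x = ?q y \<longleftrightarrow> x 0 - y 0 \<in> ?I"
      using quotient_eq_iff_same_a_r_cos[OF ideal_axioms, of "x 0" "y 0"] c0 that
        ring_of_minus(2)[of "x 0" V "y 0"] by simp
    also have "\<dots> \<longleftrightarrow> x - y \<in> monomial_vecs V U"
      using supported.submodD(5)[OF supported.submod_vecs that] c0
      by (auto simp: monomial_ideal_def monomial_vecs_def vecs_def)
    finally show ?thesis .
  qed
  show "?q 0 = \<zero>\<^bsub>quotient_module ?R ?I\<^esub>"
    using a_rcos_const[of 0] by (simp add: quotient_module_def FactRing_def monomial_ideal_def)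
qed

theorem theorem3p2:
  fixes V :: "'v set" and E :: "'v set set"
  assumes "clutter V E"
  shows "clutter_pd TYPE('k::field) V E
    \<le> ereal (real (card V) - real (edgewise_domination_number V E))"
proof -
  have finV: "finite V" and EV: "E \<subseteq> Pow V" and anti: "antichain E"
    using assms by (auto simp: clutter_def antichain_def)
  have UV: "\<Union>E \<subseteq> V" using EV by blast
  then have finU: "finite (\<Union>E)" using finV by (rule finite_subset)
  let ?eps = "edgewise_domination_number V E"
  have fin: "finite {card F |F. dominant E F}"
  proof -
    have "finite (card ` Pow E)" using finite_UnionD[OF finU] by simp
    then show ?thesis by (rule rev_finite_subset) (auto simp: dominant_def)
  qed
  have eps: "?eps = Min {card F |F. dominant E F}"
    unfolding edgewise_domination_number_def edgewise_dominant_iff[OF EV] ..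
  have eps_le: "?eps \<le> card F" if "dominant E F" for F
    unfolding eps by (rule Min_le[OF fin]) (use that in blast)
  obtain F where "dominant E F" "card F \<le> card (\<Union>E)" using dominant_exists[OF finU] .
  then have eps_V: "?eps \<le> card V" using eps_le card_mono[OF finV UV] by fastforce
  have "quotient_resolvable TYPE('k) V (Suc (card V - ?eps)) (up_closure E)"
  proof (rule quotient_resolvable_dominant[OF finU UV anti])
    show "card (\<Union>E) \<le> card V - ?eps + card F" if "dominant E F" for F
      using eps_le[OF that] card_mono[OF finV UV] by linarith
  qed
  then have "clutter_pd TYPE('k) V E \<le> ereal (real (card V - ?eps))"
    unfolding clutter_pd_def edge_ideal_eq[OF finV EV]
    by (rule projective_dimension_quotient_le[OF up_closed_up_closure])
  then show ?thesis using eps_V by (simp add: of_nat_diff)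
qed

end
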